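(* Let $\sigma,p,\rho,a>0$, $0\le\nu<p$, $m,l\in\mathbb N$, $d,\tau,\Lambda\ge1$, let $\kappa(t)=|\log t|^{-(p-\nu)/a}$, $t\in(0,1)$, with inverse $\varphi(s)=\exp\{-s^{-a/(p-\nu)}\}$, and suppose that the class $\mathcal F^m_\kappa$ (which depends on $\eta$) is nonempty for $\eta$ large. Let $\eta$ be sufficiently large (with threshold not depending on $n$) and let $\triangle\ge1$. Then there is a constant $C>0$ such that for every $n\ge2$ for which some $k^*\in\mathbb N$ satisfies $$\triangle^{-1}\le\sum_{|k|\le k^*}\frac{\gamma_{k^*}^{p-\nu}}{n\,\varphi(\gamma_k^{\nu-p})}\le\triangle$$ one has $$\inf_{\widetilde\beta}\ \sup_{\beta\in\mathcal W_p^\rho,\ (X,W)\in\mathcal F^m_\kappa,\ U\in\mathcal E^l_\eta}\mathbb E\|\widetilde\beta-\beta\|_\nu^2\ \ge\ C\,(\log n)^{-(p-\nu)/a},$$ where the infimum is over all estimators $\widetilde\beta$ based on an i.i.d. $n$-sample of $(Y,X,W)$, with $Y=\int_0^1\beta(t)X(t)\,dt+\sigma U$, and the supremum is over $\beta$ and joint distributions of $(X,W,U)$ in the indicated classes satisfying $\mathbb E[UW(t)]=0$, $t\in[0,1]$.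
   Context: Basic notation. $L^2[0,1]$ is the Hilbert space of square integrable complex-valued functions with $\langle f,g\rangle=\int_0^1 f(t)\overline{g(t)}dt$, $\|f\|=\langle f,f\rangle^{1/2}$; $\phi_k(t)=\exp(2\pi i k t)$, $k\in\mathbb Z$. Weights: $\gamma_k=1+|2\pi k|^2$. For $\nu\in\mathbb R$, $\|f\|_\nu^2=\sum_{k\in\mathbb Z}\gamma_k^\nu|\langle f,\phi_k\rangle|^2$ and $\mathcal W_\nu=\{f\in L^2[0,1]:\|f\|_\nu<\infty\}$, $\mathcal W_\nu^\rho=\{f\in\mathcal W_\nu:\|f\|_\nu^2\le\rho\}$. Model. $X,W$ are real-valued centered random functions on $[0,1]$ with $\mathbb E\|X\|^2<\infty$, $\mathbb E\|W\|^2<\infty$; $Y$ is real-valued, and the slope function $\beta$ is real-valued. Second order stationarity. $\mathcal F$ is the set of all centered second order stationary pairs $(X,W)$: covariances depend only on differences of arguments, in particular $\mathrm{Cov}(X(t),W(s))=c_{WX}(s-t)$. It is a standing property that the $\phi_k$ diagonalize the cross-covariance operator $[T_{WX}f](s)=\int_0^1 f(t)\,\mathrm{Cov}(X(t),W(s))dt$, i.e. $T_{WX}\phi_k=c_k\phi_k$; equivalently, with $c_k=\mathbb E[\langle\phi_k,X\rangle\langle W,\phi_k\rangle]$, one has $\mathbb E[\langle\phi_k,X\rangle\langle W,\phi_j\rangle]=0$ for $j\neq k$. It is also a standing assumption that $T_{WX}$ is injective, i.e. $c_k\ne0$ for all $k$. Put $x_k=\mathrm{Var}\langle X,\phi_k\rangle$,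 $w_k=\mathrm{Var}\langle W,\phi_k\rangle$ (variance of a complex variable meaning $\mathbb E|\cdot|^2$ after centering), $\lambda_k=|c_k|^2/w_k$. Moment classes. For $m\in\mathbb N$, $\eta,\tau\ge1$: $\mathcal F^m_{\eta,\tau}$ is the set of $(X,W)\in\mathcal F$ with $\sup_k\mathbb E|\langle X,\phi_k\rangle/\sqrt{x_k}|^m\le\eta$, $\sup_k\mathbb E|\langle W,\phi_k\rangle/\sqrt{w_k}|^m\le\eta$ and $\max(1,\sup_k\lambda_k/w_k)\le\tau$. $\mathcal E^m_\eta$ is the set of centered real random variables $U$ with variance one and $\mathbb E|U|^m\le\eta$. Link condition. For a nonnegative summable sequence $(\lambda_k)_{k\in\mathbb Z}$ let $\lambda_+=\max(1,\max_k\lambda_k)$. For $\kappa$ continuous strictly increasing with $\kappa(0+)=0$ and inverse $\varphi$, and $d\ge1$, $\mathcal S_{\kappa,d}$ is the set of nonnegative summable $(\lambda_k)$ with $\kappa\bigl(\frac{\lambda_k}{d\gamma_k^\nu\lambda_+}\bigr)\le\gamma_k^{\nu-p}\le\kappa\bigl(\frac{d\lambda_k}{\gamma_k^\nu\lambda_+}\bigr)$ for all $k$, understood as $d^{-1}\varphi(\gamma_k^{\nu-p})\le\frac{\lambda_k}{\gamma_k^\nu\lambda_+}\le d\,\varphi(\gamma_k^{\nu-p})$ for all $k\in\mathbb Z$. Finally, $\mathcal F^m_\kappa$ is the set of $(X,W)\in\mathcal F^m_{\eta,\tau}$ whose associated values satisfy $(\lambda_k)_{k\in\mathbb Z}\in\mathcal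 S_{\kappa,d}$ and with $\mathbb E\|X\|^2\le\Lambda$, $\mathbb E\|W\|^2\le\Lambda$. *)

theory Defs
  imports "HOL-Probability.Probability"
begin

subsection \<open>The space $L^2[0,1]$ and the Sobolev scale\<close>

text \<open>Elements of $L^2[0,1]$ are represented by functions on the real line of which only the
  restriction to $[0,1]$ matters, up to null sets. The value type is real or complex.\<close>

abbreviation leb01 :: "real measure" where
  "leb01 \<equiv> restrict_space lborel {0..1}"

definition L2 :: "(real \<Rightarrow> 'b::{real_normed_vector, second_countable_topology}) set" where
  "L2 = {f. f \<in> borel_measurable leb01 \<and> integrable leb01 (\<lambda>t. (norm (f t))\<^sup>2)}"

definition l2norm :: "(real \<Rightarrow> 'b::real_normed_vector) \<Rightarrow> real" where
  "l2norm f = sqrt (LINT t|leb01. (norm (f t))\<^sup>2)"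

definition l2inner :: "(real \<Rightarrow> complex) \<Rightarrow> (real \<Rightarrow> complex) \<Rightarrow> complex" where
  "l2inner f g = (LINT t|leb01. f t * cnj (g t))"

abbreviation cpx :: "(real \<Rightarrow> real) \<Rightarrow> real \<Rightarrow> complex" where
  "cpx f \<equiv> (\<lambda>t. complex_of_real (f t))"

definition fourier :: "int \<Rightarrow> real \<Rightarrow> complex" where
  "fourier k t = exp (2 * of_real pi * \<i> * of_int k * of_real t)"

definition gam :: "int \<Rightarrow> real" where
  "gam k = 1 + \<bar>2 * pi * of_int k\<bar>\<^sup>2"

text \<open>The squared norm $\|f\|_\nu^2$, with value $\infty$ outside $W_\nu$.\<close>

definition sobnorm_sq :: "real \<Rightarrow> (real \<Rightarrow> complex) \<Rightarrow> ennreal" where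
  "sobnorm_sq \<nu> f = (\<Sum>\<^sub>\<infinity>k\<in>UNIV. ennreal (gam k powr \<nu> * (cmod (l2inner f (fourier k)))\<^sup>2))"

definition sob_ball :: "real \<Rightarrow> real \<Rightarrow> (real \<Rightarrow> complex) set" where
  "sob_ball \<nu> \<rho> = {f \<in> L2. sobnorm_sq \<nu> f \<le> ennreal \<rho>}"

text \<open>$L^2[0,1]$ as a measurable space. Since $L^2[0,1]$ is separable, the balls generate its
  Borel $\sigma$-algebra.\<close>

definition L2_borel :: "(real \<Rightarrow> 'b::{real_normed_vector, second_countable_topology}) measure" where
  "L2_borel = sigma L2 {B. \<exists>g\<in>L2. \<exists>r. B = {f \<in> L2. l2norm (\<lambda>t. f t - g t) < r}}"


subsection \<open>Second order stationary pairs\<close>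

text \<open>A random function on a probability space \<open>M\<close> is a jointly measurable process with
  paths in $L^2[0,1]$.\<close>

definition random_function :: "'w measure \<Rightarrow> ('w \<Rightarrow> real \<Rightarrow> real) \<Rightarrow> bool" where
  "random_function M X \<longleftrightarrow>
     case_prod X \<in> borel_measurable (M \<Otimes>\<^sub>M leb01) \<and> (\<forall>\<omega>\<in>space M. X \<omega> \<in> L2)"

definition cov :: "'w measure \<Rightarrow> ('w \<Rightarrow> real) \<Rightarrow> ('w \<Rightarrow> real) \<Rightarrow> real" where
  "cov M A B = (LINT \<omega>|M. (A \<omega> - (LINT \<omega>'|M. A \<omega>')) * (B \<omega> - (LINT \<omega>'|M. B \<omega>')))"

text \<open>Centered, with finite second moments at each point and $E\|X\|^2 < \infty$.\<close>

definition centered_sq_int :: "'w measure \<Rightarrow> ('w \<Rightarrow> real \<Rightarrow> real) \<Rightarrow> bool" where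
  "centered_sq_int M X \<longleftrightarrow>
     (\<forall>t\<in>{0..1}. (\<lambda>\<omega>. X \<omega> t) \<in> borel_measurable M \<and> integrable M (\<lambda>\<omega>. (X \<omega> t)\<^sup>2) \<and>
        (LINT \<omega>|M. X \<omega> t) = 0) \<and>
     integrable M (\<lambda>\<omega>. (l2norm (X \<omega>))\<^sup>2)"

definition cross_cov_op ::
  "'w measure \<Rightarrow> ('w \<Rightarrow> real \<Rightarrow> real) \<Rightarrow> ('w \<Rightarrow> real \<Rightarrow> real) \<Rightarrow> (real \<Rightarrow> complex) \<Rightarrow> real \<Rightarrow> complex" where
  "cross_cov_op M X W f s =
     (LINT t|leb01. f t * of_real (cov M (\<lambda>\<omega>. X \<omega> t) (\<lambda>\<omega>. W \<omega> s)))"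

definition cross_coef ::
  "'w measure \<Rightarrow> ('w \<Rightarrow> real \<Rightarrow> real) \<Rightarrow> ('w \<Rightarrow> real \<Rightarrow> real) \<Rightarrow> int \<Rightarrow> complex" where
  "cross_coef M X W k =
     (LINT \<omega>|M. l2inner (fourier k) (cpx (X \<omega>)) * l2inner (cpx (W \<omega>)) (fourier k))"

text \<open>Covariances that depend only on \<open>s - t\<close> do not by themselves make the trigonometric
  basis diagonalize the cross-covariance operator on $[0,1]$ (this needs periodicity), so
  the diagonalization is a separate clause, as is injectivity (nonzero eigenvalues).\<close>

definition stationary_pair ::
  "'w measure \<Rightarrow> ('w \<Rightarrow> real \<Rightarrow> real) \<Rightarrow> ('w \<Rightarrow> real \<Rightarrow> real) \<Rightarrow> bool" where
  "stationary_pair M X W \<longleftrightarrow>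
     prob_space M \<and>
     random_function M X \<and> random_function M W \<and>
     centered_sq_int M X \<and> centered_sq_int M W \<and>
     (\<exists>c\<^sub>X c\<^sub>W c\<^sub>W\<^sub>X :: real \<Rightarrow> real. \<forall>t\<in>{0..1}. \<forall>s\<in>{0..1}.
        cov M (\<lambda>\<omega>. X \<omega> t) (\<lambda>\<omega>. X \<omega> s) = c\<^sub>X (s - t) \<and>
        cov M (\<lambda>\<omega>. W \<omega> t) (\<lambda>\<omega>. W \<omega> s) = c\<^sub>W (s - t) \<and>
        cov M (\<lambda>\<omega>. X \<omega> t) (\<lambda>\<omega>. W \<omega> s) = c\<^sub>W\<^sub>X (s - t)) \<and>
     (\<forall>k. AE s in leb01.
        cross_cov_op M X W (fourier k) s = cross_coef M X W k * fourier k s) \<and>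
     (\<forall>k. cross_coef M X W k \<noteq> 0)"

definition var_coef :: "'w measure \<Rightarrow> ('w \<Rightarrow> real \<Rightarrow> real) \<Rightarrow> int \<Rightarrow> real" where
  "var_coef M X k =
     (LINT \<omega>|M. (cmod (l2inner (cpx (X \<omega>)) (fourier k)
                    - (LINT \<omega>'|M. l2inner (cpx (X \<omega>')) (fourier k))))\<^sup>2)"

definition lam ::
  "'w measure \<Rightarrow> ('w \<Rightarrow> real \<Rightarrow> real) \<Rightarrow> ('w \<Rightarrow> real \<Rightarrow> real) \<Rightarrow> int \<Rightarrow> real" where
  "lam M X W k = (cmod (cross_coef M X W k))\<^sup>2 / var_coef M W k"


subsection \<open>Moment classes and the link condition\<close>

text \<open>$\sup_k E|\langle X,\phi_k\rangle/\sqrt{x_k}|^m$, which may be infinite.\<close>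

definition coef_moment :: "'w measure \<Rightarrow> ('w \<Rightarrow> real \<Rightarrow> real) \<Rightarrow> nat \<Rightarrow> ennreal" where
  "coef_moment M X m =
     (SUP k. \<integral>\<^sup>+\<omega>. ennreal ((cmod (l2inner (cpx (X \<omega>)) (fourier k)
                                / of_real (sqrt (var_coef M X k)))) ^ m) \<partial>M)"

definition F_moment ::
  "nat \<Rightarrow> real \<Rightarrow> real \<Rightarrow> ('w measure \<times> ('w \<Rightarrow> real \<Rightarrow> real) \<times> ('w \<Rightarrow> real \<Rightarrow> real)) set" where
  "F_moment m \<eta> \<tau> = {(M, X, W). stationary_pair M X W \<and>
     coef_moment M X m \<le> ennreal \<eta> \<and> coef_moment M W m \<le> ennreal \<eta> \<and>
     max 1 (SUP k. ennreal (lam M X W k / var_coef M W k)) \<le> ennreal \<tau>}"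

definition E_moment :: "nat \<Rightarrow> real \<Rightarrow> 'w measure \<Rightarrow> ('w \<Rightarrow> real) set" where
  "E_moment l \<eta> M = {U \<in> borel_measurable M.
     integrable M (\<lambda>\<omega>. (U \<omega>)\<^sup>2) \<and> (LINT \<omega>|M. U \<omega>) = 0 \<and> cov M U U = 1 \<and>
     (\<integral>\<^sup>+\<omega>. ennreal (\<bar>U \<omega>\<bar> ^ l) \<partial>M) \<le> ennreal \<eta>}"

definition lam_plus :: "(int \<Rightarrow> real) \<Rightarrow> real" where
  "lam_plus ls = max 1 (SUP k. ls k)"

text \<open>The link condition is read through the inverse of the index function \<open>\<kappa>\<close>, whose
  domain here is $(0,1)$: the defining inequalities in terms of \<open>\<kappa>\<close> itself would have
  arguments outside the domain.\<close>

definition link_class :: "(real \<Rightarrow> real) \<Rightarrow> real \<Rightarrow> real \<Rightarrow> real \<Rightarrow> (int \<Rightarrow> real) set" where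
  "link_class \<kappa> d \<nu> p = {ls. (\<forall>k. 0 \<le> ls k) \<and> ls summable_on UNIV \<and>
     (\<forall>k. inverse d * the_inv_into {0<..<1} \<kappa> (gam k powr (\<nu> - p))
            \<le> ls k / (gam k powr \<nu> * lam_plus ls) \<and>
          ls k / (gam k powr \<nu> * lam_plus ls)
            \<le> d * the_inv_into {0<..<1} \<kappa> (gam k powr (\<nu> - p)))}"

definition F_link ::
  "(real \<Rightarrow> real) \<Rightarrow> real \<Rightarrow> real \<Rightarrow> real \<Rightarrow> nat \<Rightarrow> real \<Rightarrow> real \<Rightarrow> real \<Rightarrow>
   ('w measure \<times> ('w \<Rightarrow> real \<Rightarrow> real) \<times> ('w \<Rightarrow> real \<Rightarrow> real)) set" where
  "F_link \<kappa> d \<nu> p m \<eta> \<tau> \<Lambda> = {(M, X, W). (M, X, W) \<in> F_moment m \<eta> \<tau> \<and>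
     lam M X W \<in> link_class \<kappa> d \<nu> p \<and>
     (LINT \<omega>|M. (l2norm (X \<omega>))\<^sup>2) \<le> \<Lambda> \<and> (LINT \<omega>|M. (l2norm (W \<omega>))\<^sup>2) \<le> \<Lambda>}"

text \<open>On $(0,1)$ the logarithmic index function has the stated inverse on all of $(0,\infty)$.\<close>

lemma the_inv_into_log_index:
  fixes \<kappa> :: "real \<Rightarrow> real" and a p \<nu> s :: real
  assumes "a > 0" "\<nu> < p" "s > 0"
    and \<kappa>: "\<And>t. t \<in> {0<..<1} \<Longrightarrow> \<kappa> t = \<bar>ln t\<bar> powr (- ((p - \<nu>) / a))"
  shows "the_inv_into {0<..<1} \<kappa> s = exp (- (s powr (- (a / (p - \<nu>)))))"
proof -
  define b where "b = (p - \<nu>) / a"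
  have b: "b > 0" "a / (p - \<nu>) = 1 / b" using assms by (auto simp: b_def)
  have inj: "inj_on \<kappa> {0<..<1}"
  proof (rule inj_onI)
    fix x y :: real assume xy: "x \<in> {0<..<1}" "y \<in> {0<..<1}" "\<kappa> x = \<kappa> y"
    then have l: "ln x < 0" "ln y < 0" by auto
    from xy have "\<bar>ln x\<bar> powr (- b) = \<bar>ln y\<bar> powr (- b)" by (simp add: \<kappa> b_def)
    then have "(\<bar>ln x\<bar> powr (- b)) powr (- (1/b)) = (\<bar>ln y\<bar> powr (- b)) powr (- (1/b))" by simp
    then have "\<bar>ln x\<bar> = \<bar>ln y\<bar>" using b l by (simp add: powr_powr)
    then show "x = y" using l xy by simp
  qed
  let ?t = "exp (- (s powr (- (1 / b))))"
  have t: "?t \<in> {0<..<1}" using assms by simp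
  have "\<kappa> ?t = s" using \<kappa>[OF t] b assms by (simp add: b_def[symmetric] powr_powr)
  then show ?thesis using the_inv_into_f_eq[OF inj _ t] b by simp
qed


subsection \<open>Estimators and risk\<close>

text \<open>An estimator may take any values in the complex space $L^2[0,1]$.\<close>

definition estimators ::
  "nat \<Rightarrow> ((nat \<Rightarrow> real \<times> (real \<Rightarrow> real) \<times> (real \<Rightarrow> real)) \<Rightarrow> real \<Rightarrow> complex) set" where
  "estimators n =
     (PiM {..<n} (\<lambda>_. borel \<Otimes>\<^sub>M (L2_borel \<Otimes>\<^sub>M L2_borel))) \<rightarrow>\<^sub>M L2_borel"

definition response ::
  "real \<Rightarrow> (real \<Rightarrow> real) \<Rightarrow> ('w \<Rightarrow> real \<Rightarrow> real) \<Rightarrow> ('w \<Rightarrow> real) \<Rightarrow> 'w \<Rightarrow> real" where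
  "response \<sigma> \<beta> X U \<omega> = (LINT t|leb01. \<beta> t * X \<omega> t) + \<sigma> * U \<omega>"

text \<open>$E\|\tilde\beta - \beta\|_\nu^2$ for an i.i.d. sample of size \<open>n\<close>, realized on the
  \<open>n\<close>-fold product of the underlying probability space.\<close>

definition risk ::
  "real \<Rightarrow> real \<Rightarrow> nat \<Rightarrow> ((nat \<Rightarrow> real \<times> (real \<Rightarrow> real) \<times> (real \<Rightarrow> real)) \<Rightarrow> real \<Rightarrow> complex) \<Rightarrow>
   (real \<Rightarrow> real) \<Rightarrow> 'w measure \<Rightarrow> ('w \<Rightarrow> real \<Rightarrow> real) \<Rightarrow> ('w \<Rightarrow> real \<Rightarrow> real) \<Rightarrow> ('w \<Rightarrow> real) \<Rightarrow> ennreal" where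
  "risk \<sigma> \<nu> n est \<beta> M X W U =
     (\<integral>\<^sup>+\<omega>. sobnorm_sq \<nu> (\<lambda>t. est (\<lambda>i\<in>{..<n}. (response \<sigma> \<beta> X U (\<omega> i), X (\<omega> i), W (\<omega> i))) t
                             - of_real (\<beta> t))
        \<partial>(PiM {..<n} (\<lambda>_. M)))"

text \<open>The set over which the supremum is taken. Joint distributions of $(X,W,U)$ are
  represented by arbitrary probability measures, on arbitrary $\sigma$-algebras, whose sample
  space is a subset of the type of real sequences. Since $L^2[0,1] \times L^2[0,1] \times R$
  is Polish, every joint distribution is realized in this way.\<close>

type_synonym \<Omega> = "nat \<Rightarrow> real"

definition models ::
  "(real \<Rightarrow> real) \<Rightarrow> real \<Rightarrow> real \<Rightarrow> real \<Rightarrow> real \<Rightarrow> nat \<Rightarrow> nat \<Rightarrow> real \<Rightarrow> real \<Rightarrow> real \<Rightarrow>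
   ((real \<Rightarrow> real) \<times> \<Omega> measure \<times> (\<Omega> \<Rightarrow> real \<Rightarrow> real) \<times> (\<Omega> \<Rightarrow> real \<Rightarrow> real) \<times> (\<Omega> \<Rightarrow> real)) set" where
  "models \<kappa> d \<nu> p \<rho> m l \<eta> \<tau> \<Lambda> = {(\<beta>, M, X, W, U).
     cpx \<beta> \<in> sob_ball p \<rho> \<and>
     (M, X, W) \<in> F_link \<kappa> d \<nu> p m \<eta> \<tau> \<Lambda> \<and>
     U \<in> E_moment l \<eta> M \<and>
     (\<forall>t\<in>{0..1}. (LINT \<omega>|M. U \<omega> * W \<omega> t) = 0)}"

end

theory Submission
  imports Defs "HOL-Real_Asymp.Real_Asymp"
begin

text \<open>Only the sequence \<open>\<lambda>\<close> of some pair in the class is needed. Take \<open>X = W\<close> to be a randomly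
  shifted, randomly signed periodic function with squared Fourier coefficients \<open>\<lambda>\<^sub>k\<close>; this pair lies
  in the class for every \<open>\<eta> \<ge> 1\<close>. Perturb the slope along one frequency, \<open>\<beta> = \<plusminus>2 b cos (2 \<pi> k t)\<close>,
  and let the noise cancel the signal \<open>\<langle>\<beta>, X\<rangle>\<close> except on an event of probability \<open>q = 1/(2 n)\<close>, on
  which it overcompensates so as to stay uncorrelated with \<open>W\<close>. With probability at least \<open>1/2\<close> the
  two samples coincide, so one of the two risks is at least \<open>\<gamma>\<^sub>k\<^sup>\<nu> b\<^sup>2 / 2\<close>. The noise is
  bounded if \<open>n b \<surd>\<lambda>\<^sub>k\<close> is of order \<open>\<sigma>\<close>. As \<open>\<lambda>\<^sub>k\<close> is of order \<open>\<gamma>\<^sub>k\<^sup>\<nu> exp (- \<gamma>\<^sub>k\<^sup>a)\<close>, this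
  allows \<open>b\<^sup>2\<close> of order \<open>\<gamma>\<^sub>k\<^bsup>-p\<^esup>\<close> as soon as \<open>\<gamma>\<^sub>k\<^sup>a \<ge> 2 ln n\<close>: because the
  problem is severely ill-posed, the union bound over the sample, which is wasteful by a factor
  \<open>\<surd>n\<close> in \<open>b\<close>, affects constants only.\<close>

subsection \<open>Fourier series on the unit interval\<close>

interpretation leb01: prob_space leb01
  by (auto intro!: prob_spaceI simp: space_restrict_space emeasure_restrict_space)

lemma space_leb01 [simp]: "space leb01 = {0..1}"
  by (simp add: space_restrict_space)

lemma borel_measurable_leb01 [measurable (raw)]:
  "f \<in> borel_measurable borel \<Longrightarrow> f \<in> borel_measurable leb01"
  by (simp add: measurable_restrict_space1)

lemma integrable_bounded_leb01:
  fixes f :: "real \<Rightarrow> 'b::{banach, second_countable_topology}"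
  assumes "f \<in> borel_measurable leb01" "\<And>t. norm (f t) \<le> B"
  shows "integrable leb01 f"
  using assms by (intro leb01.integrable_const_bound[where B = B]) auto

lemma fourier_eq_cis: "fourier k t = cis (2 * pi * of_int k * t)"
  by (simp add: fourier_def cis_conv_exp mult_ac)

lemma norm_fourier [simp]: "cmod (fourier k t) = 1"
  by (simp add: fourier_eq_cis)

lemma cnj_fourier: "cnj (fourier k t) = fourier (- k) t"
  by (simp add: fourier_eq_cis cis_cnj)

lemma fourier_add: "fourier (j + k) t = fourier j t * fourier k t"
  by (simp add: fourier_eq_cis cis_mult algebra_simps)

lemma fourier_diff: "fourier k (s - t) = fourier k s * fourier (- k) t"
  by (simp add: fourier_eq_cis cis_mult algebra_simps)

lemma fourier_0 [simp]: "fourier 0 t = 1"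
  by (simp add: fourier_eq_cis)

lemma fourier_mult_neg [simp]: "fourier k t * fourier (- k) t = 1" "fourier (- k) t * fourier k t = 1"
  by (simp_all flip: fourier_add)

lemma continuous_fourier [continuous_intros]: "continuous_on A (fourier k)"
  unfolding fourier_def by (intro continuous_intros)

lemma measurable_fourier [measurable]: "fourier k \<in> borel_measurable borel"
  by (intro borel_measurable_continuous_onI continuous_fourier)

lemma integral_fourier: "(LINT t|leb01. fourier k t) = (if k = 0 then 1 else 0)"
proof (cases "k = 0")
  case False
  define c where "c = 2 * of_real pi * \<i> * complex_of_int k"
  have c: "c \<noteq> 0" using False by (simp add: c_def)
  have F: "((\<lambda>t. exp (c * of_real t) / c) has_vector_derivative fourier k t) (at t within {0..1})" for t
  proof -
    have "((\<lambda>z. exp (c * z) / c) has_field_derivative fourier k t) (at (of_real t))"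
      using c by (auto intro!: derivative_eq_intros simp: fourier_def c_def)
    from has_vector_derivative_real_field[OF this] show ?thesis by simp
  qed
  have "(LINT t|leb01. fourier k t) = (LINT t|lborel. indicator {0..1} t *\<^sub>R fourier k t)"
    by (simp add: integral_restrict_space)
  also have "\<dots> = exp (c * of_real 1) / c - exp (c * of_real 0) / c"
    by (rule integral_FTC_Icc[OF _ F]) (auto intro!: continuous_intros)
  also have "exp (c * of_real 1) = fourier k 1" by (simp add: fourier_def c_def)
  also have "fourier k 1 = 1"
    using cis_multiple_2pi[of "of_int k"] by (simp add: fourier_eq_cis)
  finally show ?thesis using False by simp
qed (use leb01.prob_space in simp)

lemma integral_fourier_mult:
  "(LINT t|leb01. fourier j t * fourier (- k) t) = (if j = k then 1 else 0)"
  using integral_fourier[of "j + - k"] unfolding fourier_add by simp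

definition cos_series :: "(int \<Rightarrow> real) \<Rightarrow> real \<Rightarrow> real" where
  "cos_series g s = (LINT k|count_space UNIV. g k * cos (2 * pi * of_int k * s))"

lemma cos_series_minus: "cos_series g (- s) = cos_series g s"
  by (simp add: cos_series_def)

lemma measurable_count_space_pair:
  fixes f :: "int \<Rightarrow> 'a \<Rightarrow> 'b::topological_space"
  assumes "\<And>k. f k \<in> borel_measurable M"
  shows "(\<lambda>(x, k). f k x) \<in> borel_measurable (M \<Otimes>\<^sub>M count_space UNIV)"
    and "(\<lambda>(k, x). f k x) \<in> borel_measurable (count_space UNIV \<Otimes>\<^sub>M M)"
proof -
  show "(\<lambda>(k, x). f k x) \<in> borel_measurable (count_space UNIV \<Otimes>\<^sub>M M)"
    using assms by (intro measurable_pair_measure_countable1) auto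
  from measurable_compose[OF measurable_pair_swap' this]
  show "(\<lambda>(x, k). f k x) \<in> borel_measurable (M \<Otimes>\<^sub>M count_space UNIV)"
    by (simp add: case_prod_unfold)
qed

interpretation cs: sigma_finite_measure "count_space (UNIV :: int set)"
  by (rule sigma_finite_measure_count_space)

lemma measurable_cos_series [measurable]: "cos_series g \<in> borel_measurable borel"
proof -
  have "(\<lambda>s. LINT k|count_space (UNIV::int set). g k * cos (2 * pi * of_int k * s)) \<in> borel_measurable borel"
    by (rule cs.borel_measurable_lebesgue_integral, rule measurable_count_space_pair(1)) measurable
  then show ?thesis by (simp add: cos_series_def[abs_def])
qed

lemma integral_count_space_delta:
  fixes h :: "int \<Rightarrow> complex"
  shows "(LINT j|count_space UNIV. h j * (if k = j then 1 else 0)) = h k"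
proof -
  have "{j \<in> UNIV. h j * (if k = j then 1 else 0) \<noteq> 0} \<subseteq> {k}"
    by (auto split: if_splits)
  then have "(\<Sum>j | j \<in> UNIV \<and> h j * (if k = j then 1 else 0) \<noteq> 0. h j * (if k = j then 1 else 0))
      = (\<Sum>j\<in>{k}. h j * (if k = j then 1 else 0))"
    by (intro sum.mono_neutral_left) auto
  moreover have "finite {j \<in> UNIV. h j * (if k = j then 1 else 0) \<noteq> 0}"
    using \<open>_ \<subseteq> {k}\<close> by (rule finite_subset) simp
  ultimately show ?thesis
    by (subst lebesgue_integral_count_space_finite_support) auto
qed

locale sym_summable =
  fixes g :: "int \<Rightarrow> real"
  assumes summable: "integrable (count_space UNIV) g"
    and sym: "g (- k) = g k"
begin

lemma integrable_mult_bounded: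
  fixes h :: "int \<Rightarrow> 'b::{real_normed_algebra_1, banach, second_countable_topology}"
  assumes "\<And>k. norm (h k) \<le> B"
  shows "integrable (count_space UNIV) (\<lambda>k. of_real (g k) * h k)"
proof (rule Bochner_Integration.integrable_bound)
  show "integrable (count_space UNIV) (\<lambda>k. \<bar>g k\<bar> * B)" using summable by simp
  have "norm (of_real (g k) * h k) \<le> norm (\<bar>g k\<bar> * B)" for k
  proof -
    have "norm (of_real (g k) * h k) \<le> \<bar>g k\<bar> * norm (h k)"
      using norm_mult_ineq[of "of_real (g k)" "h k"] by simp
    also have "\<dots> \<le> \<bar>g k\<bar> * \<bar>B\<bar>" using assms[of k] by (intro mult_left_mono) auto
    finally show ?thesis by (simp add: abs_mult)
  qed
  then show "AE k in count_space UNIV. norm (of_real (g k) * h k) \<le> norm (\<bar>g k\<bar> * B)" by simp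
qed simp

lemma cos_series_bound: "\<bar>cos_series g s\<bar> \<le> (LINT k|count_space UNIV. \<bar>g k\<bar>)"
proof -
  have "\<bar>cos_series g s\<bar> \<le> (LINT k|count_space UNIV. \<bar>g k * cos (2 * pi * of_int k * s)\<bar>)"
    unfolding cos_series_def by (rule integral_abs_bound)
  also have "\<dots> \<le> (LINT k|count_space UNIV. \<bar>g k\<bar>)"
    using summable integrable_abs[OF integrable_mult_bounded[of "\<lambda>k. cos (2 * pi * of_int k * s)" 1]]
    by (intro integral_mono) (auto simp: abs_mult mult_left_le)
  finally show ?thesis .
qed

lemma cos_series_fourier:
  "complex_of_real (cos_series g s) = (LINT k|count_space UNIV. of_real (g k) * fourier k s)"
proof (rule complex_eqI)
  let ?I = "LINT k|count_space UNIV. complex_of_real (g k) * fourier k s"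
  have int: "integrable (count_space UNIV) (\<lambda>k. complex_of_real (g k) * fourier k s)"
    by (rule integrable_mult_bounded[where B = 1]) simp
  show "Re (of_real (cos_series g s)) = Re ?I"
    using integral_Re[OF int] by (simp add: cos_series_def fourier_eq_cis)
  have "bij_betw uminus (UNIV :: int set) UNIV" by (rule bij_uminus)
  then have "(LINT k|count_space UNIV. g (- k) * sin (2 * pi * of_int (- k) * s)) =
        (LINT k|count_space UNIV. g k * sin (2 * pi * of_int k * s))"
    by (rule integral_bij_count_space)
  moreover have "Im ?I = (LINT k|count_space UNIV. g k * sin (2 * pi * of_int k * s))"
    using integral_Im[OF int] by (simp add: fourier_eq_cis)
  ultimately show "Im (of_real (cos_series g s)) = Im ?I" by (simp add: sym)
qed

lemma integral_times_cos_series: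
  fixes f :: "real \<Rightarrow> complex"
  assumes f[measurable]: "f \<in> borel_measurable borel" and B: "\<And>t. cmod (f t) \<le> B"
  shows "(LINT t|leb01. f t * cos_series g (s - t)) =
    (LINT k|count_space UNIV. of_real (g k) * (fourier k s * (LINT t|leb01. f t * fourier (- k) t)))"
proof -
  interpret P: pair_sigma_finite leb01 "count_space (UNIV :: int set)" ..
  let ?h = "\<lambda>t k. f t * (of_real (g k) * fourier k (s - t))"
  have B0: "0 \<le> B" using order_trans[OF norm_ge_zero B] .
  have m: "case_prod ?h \<in> borel_measurable (leb01 \<Otimes>\<^sub>M count_space UNIV)"
    by (rule measurable_count_space_pair(1)) measurable
  have int: "integrable (leb01 \<Otimes>\<^sub>M count_space UNIV) (case_prod ?h)"
  proof (rule P.Fubini_integrable[OF m])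
    have "(LINT k|count_space UNIV. norm (case_prod ?h (t, k))) = cmod (f t) * (LINT k|count_space UNIV. \<bar>g k\<bar>)" for t
      by (simp add: norm_mult)
    then show "integrable leb01 (\<lambda>t. LINT k|count_space UNIV. norm (case_prod ?h (t, k)))"
      using B by (auto intro!: integrable_norm integrable_bounded_leb01[where B = B])
    show "AE t in leb01. integrable (count_space UNIV) (\<lambda>k. case_prod ?h (t, k))"
      using integrable_mult_bounded[of "\<lambda>k. fourier k (s - t)" 1 for t] by simp
  qed
  have "(LINT t|leb01. f t * cos_series g (s - t)) = (LINT t|leb01. LINT k|count_space UNIV. ?h t k)"
    by (simp add: cos_series_fourier)
  also have "\<dots> = (LINT k|count_space UNIV. LINT t|leb01. ?h t k)"
    using P.Fubini_integral[of ?h] int by simp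
  also have "\<dots> = (LINT k|count_space UNIV. of_real (g k) * (fourier k s * (LINT t|leb01. f t * fourier (- k) t)))"
  proof (rule Bochner_Integration.integral_cong[OF refl])
    fix k
    have "(LINT t|leb01. ?h t k) = (LINT t|leb01. (of_real (g k) * fourier k s) * (f t * fourier (- k) t))"
      by (simp add: fourier_diff mult_ac)
    also have "\<dots> = (of_real (g k) * fourier k s) * (LINT t|leb01. f t * fourier (- k) t)"
      by (rule integral_mult_right_zero)
    finally show "(LINT t|leb01. ?h t k) = of_real (g k) * (fourier k s * (LINT t|leb01. f t * fourier (- k) t))"
      by (simp add: mult.assoc)
  qed
  finally show ?thesis .
qed

lemma fourier_cos_series: "(LINT t|leb01. fourier k t * cos_series g (s - t)) = g k * fourier k s"
  using integral_times_cos_series[of "fourier k" 1 s]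
  by (simp add: integral_fourier_mult integral_count_space_delta flip: mult.assoc)

lemma sq_summable: "sym_summable (\<lambda>k. (g k)\<^sup>2)"
proof -
  have "\<bar>g k\<bar> \<le> (LINT k|count_space UNIV. \<bar>g k\<bar>)" for k
  proof -
    have "integrable (count_space UNIV) (indicator {k} :: int \<Rightarrow> real)"
      by (intro integrable_real_indicator) (auto simp: emeasure_count_space)
    from integrable_mult_right[OF this, of "\<bar>g k\<bar>"] integrable_abs[OF summable]
    have "(LINT j|count_space UNIV. \<bar>g k\<bar> * indicator {k} j) \<le> (LINT k|count_space UNIV. \<bar>g k\<bar>)"
      by (rule integral_mono) (auto simp: indicator_def)
    also have "(LINT j|count_space UNIV. \<bar>g k\<bar> * indicator {k} j) = \<bar>g k\<bar> * measure (count_space UNIV) {k}"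
      by (subst integral_mult_right_zero, subst Bochner_Integration.integral_indicator) simp
    finally show ?thesis by (simp add: measure_count_space)
  qed
  from integrable_mult_bounded[of g, OF this[folded real_norm_def]] show ?thesis
    by unfold_locales (simp_all add: power2_eq_square sym)
qed

lemma autocorrelation_cos_series:
  "(LINT v|leb01. cos_series g (t - v) * cos_series g (s - v)) = cos_series (\<lambda>k. (g k)\<^sup>2) (s - t)"
proof -
  interpret sq: sym_summable "\<lambda>k. (g k)\<^sup>2" by (rule sq_summable)
  have inner: "(LINT v|leb01. complex_of_real (cos_series g (t - v)) * fourier (- k) v) = g k * fourier (- k) t" for k
    using fourier_cos_series[of "- k" t] by (simp add: sym mult.commute)
  have "complex_of_real (LINT v|leb01. cos_series g (t - v) * cos_series g (s - v)) =
      (LINT v|leb01. complex_of_real (cos_series g (t - v)) * of_real (cos_series g (s - v)))"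
    by (simp flip: integral_complex_of_real)
  also have "\<dots> = (LINT k|count_space UNIV. of_real (g k) * (fourier k s * (g k * fourier (- k) t)))"
    using cos_series_bound
    by (subst integral_times_cos_series[where B = "LINT k|count_space UNIV. \<bar>g k\<bar>"]) (auto simp: inner)
  also have "\<dots> = (LINT k|count_space UNIV. of_real ((g k)\<^sup>2) * fourier k (s - t))"
    by (simp add: fourier_diff power2_eq_square mult_ac)
  also have "\<dots> = of_real (cos_series (\<lambda>k. (g k)\<^sup>2) (s - t))"
    by (rule sq.cos_series_fourier[symmetric])
  finally show ?thesis by (simp only: of_real_eq_iff)
qed

end

subsection \<open>The space $L^2[0,1]$\<close>

lemma measurable_cnj [measurable]: "cnj \<in> borel_measurable borel"
  by (intro borel_measurable_continuous_onI continuous_intros)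

lemma L2D:
  assumes "f \<in> L2"
  shows "f \<in> borel_measurable leb01" "integrable leb01 (\<lambda>t. (norm (f t))\<^sup>2)"
  using assms by (auto simp: L2_def)

lemma l2norm_sq: "(l2norm f)\<^sup>2 = (LINT t|leb01. (norm (f t))\<^sup>2)"
  unfolding l2norm_def by (intro real_sqrt_pow2 integral_nonneg_AE) simp

lemma bounded_in_L2:
  fixes f :: "real \<Rightarrow> 'b::{banach, second_countable_topology}"
  assumes "f \<in> borel_measurable leb01" "\<And>t. norm (f t) \<le> B"
  shows "f \<in> L2"
  using assms unfolding L2_def
  by (auto intro!: integrable_bounded_leb01[where B = "B\<^sup>2"] power_mono)

lemma L2_mult_const:
  fixes f :: "real \<Rightarrow> complex"
  assumes "f \<in> L2" shows "(\<lambda>t. c * f t) \<in> L2"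
  using assms by (auto simp: L2_def norm_mult power_mult_distrib)

lemma cpx_in_L2: "f \<in> L2 \<Longrightarrow> cpx f \<in> L2"
  by (auto simp: L2_def)

lemma l2norm_cpx: "l2norm (cpx f) = l2norm f"
  by (simp add: l2norm_def)

lemma fourier_in_L2: "fourier k \<in> L2"
  by (rule bounded_in_L2[where B = 1]) auto

lemma integrable_L2_mult:
  fixes f g :: "real \<Rightarrow> complex"
  assumes "f \<in> L2" "g \<in> L2"
  shows "integrable leb01 (\<lambda>t. f t * cnj (g t))"
proof (rule Bochner_Integration.integrable_bound)
  note [measurable] = L2D(1)[OF assms(1)] L2D(1)[OF assms(2)]
  show "(\<lambda>t. f t * cnj (g t)) \<in> borel_measurable leb01" by measurable
  show "integrable leb01 (\<lambda>t. (cmod (f t))\<^sup>2 + (cmod (g t))\<^sup>2)"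
    using L2D(2)[OF assms(1)] L2D(2)[OF assms(2)] by simp
  have "cmod (f t) * cmod (g t) \<le> (cmod (f t))\<^sup>2 + (cmod (g t))\<^sup>2" for t
    using sum_squares_bound[of "cmod (f t)" "cmod (g t)"]
      mult_nonneg_nonneg[OF norm_ge_zero[of "f t"] norm_ge_zero[of "g t"]]
    by (simp only: mult.assoc)
  then show "AE t in leb01. norm (f t * cnj (g t)) \<le> norm ((cmod (f t))\<^sup>2 + (cmod (g t))\<^sup>2)"
    by (simp add: norm_mult)
qed

lemma l2inner_diff_left:
  "\<lbrakk>f \<in> L2; g \<in> L2; h \<in> L2\<rbrakk> \<Longrightarrow> l2inner (\<lambda>t. f t - g t) h = l2inner f h - l2inner g h"
  using integrable_L2_mult[of f h] integrable_L2_mult[of g h]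
  by (simp add: l2inner_def left_diff_distrib)

lemma l2inner_swap: "l2inner g f = cnj (l2inner f g)"
  unfolding l2inner_def Bochner_Integration.integral_cnj[symmetric] by (simp add: mult.commute)

lemma l2inner_fourier: "l2inner (fourier j) (fourier k) = (if j = k then 1 else 0)"
  by (simp add: l2inner_def cnj_fourier integral_fourier_mult)

lemma l2norm_diff_sq:
  fixes f g :: "real \<Rightarrow> complex"
  assumes "f \<in> L2" "g \<in> L2"
  shows "(l2norm (\<lambda>t. f t - g t))\<^sup>2 = (l2norm f)\<^sup>2 + (l2norm g)\<^sup>2 - 2 * Re (l2inner f g)"
proof -
  have "(l2norm (\<lambda>t. f t - g t))\<^sup>2 = (LINT t|leb01. (cmod (f t))\<^sup>2 + (cmod (g t))\<^sup>2 - 2 * Re (f t * cnj (g t)))"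
    unfolding l2norm_sq
    by (intro Bochner_Integration.integral_cong) (auto simp: cmod_power2, simp add: power2_eq_square algebra_simps)
  also have "\<dots> = (l2norm f)\<^sup>2 + (l2norm g)\<^sup>2 - 2 * Re (l2inner f g)"
    using L2D(2)[OF assms(1)] L2D(2)[OF assms(2)] integrable_L2_mult[OF assms]
    by (simp only: l2norm_sq l2inner_def Bochner_Integration.integral_diff Bochner_Integration.integral_add
         Bochner_Integration.integrable_add integrable_mult_right integrable_Re integral_mult_right_zero integral_Re)
  finally show ?thesis .
qed

lemma bessel_inequality:
  assumes "f \<in> L2" "finite F"
  shows "(\<Sum>k\<in>F. (cmod (l2inner f (fourier k)))\<^sup>2) \<le> (l2norm f)\<^sup>2"
proof -
  define c where "c k = l2inner f (fourier k)" for k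
  define s where "s t = (\<Sum>k\<in>F. c k * fourier k t)" for t
  have [measurable]: "s \<in> borel_measurable leb01" unfolding s_def by measurable
  have s: "s \<in> L2"
  proof (rule bounded_in_L2)
    show "cmod (s t) \<le> (\<Sum>k\<in>F. cmod (c k))" for t
      unfolding s_def by (rule order_trans[OF norm_sum]) (simp add: norm_mult)
  qed measurable
  have *: "l2inner h s = (\<Sum>k\<in>F. cnj (c k) * l2inner h (fourier k))" if "h \<in> L2" for h
  proof -
    have "l2inner h s = (LINT t|leb01. (\<Sum>k\<in>F. cnj (c k) * (h t * cnj (fourier k t))))"
      by (simp add: l2inner_def s_def sum_distrib_left mult_ac)
    also have "\<dots> = (\<Sum>k\<in>F. cnj (c k) * l2inner h (fourier k))"
      using integrable_L2_mult[OF that fourier_in_L2] by (simp add: l2inner_def)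
    finally show ?thesis .
  qed
  have "l2inner s (fourier k) = (if k \<in> F then c k else 0)" for k
  proof -
    have "l2inner s (fourier k) = cnj (l2inner (fourier k) s)" by (rule l2inner_swap)
    also have "\<dots> = (\<Sum>j\<in>F. c j * (if j = k then 1 else 0))"
      by (simp add: *[OF fourier_in_L2] l2inner_fourier eq_commute[of k]
          if_distrib[of cnj] cong: if_cong)
    finally show ?thesis using assms(2) by (simp add: if_distrib[of "(*) _"] cong: if_cong)
  qed
  then have ss: "l2inner s s = (\<Sum>k\<in>F. of_real ((cmod (c k))\<^sup>2))"
    using *[OF s] by (simp add: complex_norm_square mult.commute flip: of_real_power)
  have fs: "l2inner f s = (\<Sum>k\<in>F. of_real ((cmod (c k))\<^sup>2))"
    using *[OF assms(1)] by (simp add: complex_norm_square mult.commute c_def[symmetric] flip: of_real_power)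
  have "of_real ((l2norm s)\<^sup>2) = l2inner s s"
    by (simp add: l2norm_sq l2inner_def complex_norm_square flip: integral_complex_of_real of_real_power)
  then have "(l2norm s)\<^sup>2 = (\<Sum>k\<in>F. (cmod (c k))\<^sup>2)"
    unfolding ss by (simp only: of_real_eq_iff flip: of_real_sum)
  moreover have "Re (l2inner f s) = (\<Sum>k\<in>F. (cmod (c k))\<^sup>2)"
    unfolding fs by simp
  moreover have "0 \<le> (l2norm (\<lambda>t. f t - s t))\<^sup>2" by simp
  ultimately show ?thesis
    unfolding l2norm_diff_sq[OF assms(1) s] c_def by simp
qed

lemma space_L2_borel [simp]: "space L2_borel = L2"
  unfolding L2_borel_def by (rule space_measure_of) auto

lemma measurable_dist_L2_borel:
  assumes "g \<in> L2"
  shows "(\<lambda>f. l2norm (\<lambda>t. f t - g t)) \<in> borel_measurable L2_borel"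
proof (subst borel_measurable_iff_less, intro allI)
  fix r
  have "{f \<in> L2. l2norm (\<lambda>t. f t - g t) < r} \<in> sets L2_borel"
    unfolding L2_borel_def using assms by (subst sets_measure_of) (auto intro!: sigma_sets.Basic)
  then show "{f \<in> space L2_borel. l2norm (\<lambda>t. f t - g t) < r} \<in> sets L2_borel" by simp
qed

lemma measurable_l2inner:
  assumes g: "g \<in> L2"
  shows "(\<lambda>f. l2inner f g) \<in> borel_measurable L2_borel"
proof -
  have z: "(\<lambda>t. 0) \<in> (L2 :: (real \<Rightarrow> complex) set)" by (simp add: L2_def)
  have Re: "(\<lambda>f. Re (l2inner f h)) \<in> borel_measurable L2_borel" if h: "h \<in> L2" for h
  proof (subst measurable_cong)
    show "Re (l2inner f h) = ((l2norm (\<lambda>t. f t - 0))\<^sup>2 + (l2norm h)\<^sup>2 - (l2norm (\<lambda>t. f t - h t))\<^sup>2) / 2"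
      if "f \<in> space L2_borel" for f
      using l2norm_diff_sq[of f h] that h by simp
    note [measurable] = measurable_dist_L2_borel[OF h] measurable_dist_L2_borel[OF z]
    show "(\<lambda>f. ((l2norm (\<lambda>t. f t - 0))\<^sup>2 + (l2norm h)\<^sup>2 - (l2norm (\<lambda>t. f t - h t))\<^sup>2) / 2) \<in> borel_measurable L2_borel"
      by measurable
  qed
  have ig: "(\<lambda>t. \<i> * g t) \<in> L2" using g by (rule L2_mult_const)
  have "l2inner f g = Complex (Re (l2inner f g)) (Re (l2inner f (\<lambda>t. \<i> * g t)))" for f
  proof -
    have "l2inner f (\<lambda>t. \<i> * g t) = (LINT t|leb01. - \<i> * (f t * cnj (g t)))"
      by (simp add: l2inner_def mult_ac)
    also have "\<dots> = - \<i> * l2inner f g"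
      unfolding l2inner_def by (rule integral_mult_right_zero)
    finally show ?thesis by (simp add: complex_eq_iff)
  qed
  moreover have "(\<lambda>f. Complex (Re (l2inner f g)) (Re (l2inner f (\<lambda>t. \<i> * g t)))) \<in> borel_measurable L2_borel"
    unfolding Complex_eq using Re[OF g] Re[OF ig] by measurable
  ultimately show ?thesis by simp
qed

lemma measurable_random_function:
  assumes "random_function M X"
  shows "X \<in> M \<rightarrow>\<^sub>M L2_borel"
  unfolding L2_borel_def
proof (rule measurable_measure_of)
  show "X \<in> space M \<rightarrow> L2" using assms by (auto simp: random_function_def)
  fix B assume "B \<in> {B. \<exists>g::real \<Rightarrow> real\<in>L2. \<exists>r. B = {f \<in> L2. l2norm (\<lambda>t. f t - g t) < r}}"
  then obtain g :: "real \<Rightarrow> real" and r where g: "g \<in> L2" and B: "B = {f \<in> L2. l2norm (\<lambda>t. f t - g t) < r}" by auto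
  have [measurable]: "g \<in> borel_measurable leb01" using g by (rule L2D)
  have [measurable]: "case_prod X \<in> borel_measurable (M \<Otimes>\<^sub>M leb01)"
    using assms by (simp add: random_function_def)
  have "(\<lambda>\<omega>. l2norm (\<lambda>t. X \<omega> t - g t)) \<in> borel_measurable M"
    unfolding l2norm_def by measurable
  then have "{\<omega> \<in> space M. l2norm (\<lambda>t. X \<omega> t - g t) < r} \<in> sets M" by measurable
  also have "{\<omega> \<in> space M. l2norm (\<lambda>t. X \<omega> t - g t) < r} = X -` B \<inter> space M"
    using assms by (auto simp: B random_function_def)
  finally show "X -` B \<inter> space M \<in> sets M" .
qed auto

lemma measurable_coef:
  assumes "random_function M X"
  shows "(\<lambda>\<omega>. l2inner (cpx (X \<omega>)) (fourier k)) \<in> borel_measurable M"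
proof -
  have [measurable]: "case_prod X \<in> borel_measurable (M \<Otimes>\<^sub>M leb01)"
    using assms by (simp add: random_function_def)
  have [measurable]: "(\<lambda>x. fourier k (snd x)) \<in> borel_measurable (M \<Otimes>\<^sub>M leb01)"
    by (rule measurable_compose[OF measurable_snd borel_measurable_leb01]) measurable
  show ?thesis unfolding l2inner_def by measurable
qed

subsection \<open>Eigenvalues of stationary pairs\<close>

lemma cauchy_schwarz_integral:
  fixes f g :: "'a \<Rightarrow> complex"
  assumes [measurable]: "f \<in> borel_measurable M" "g \<in> borel_measurable M"
    and f: "integrable M (\<lambda>x. (cmod (f x))\<^sup>2)" and g: "integrable M (\<lambda>x. (cmod (g x))\<^sup>2)"
  shows "(cmod (LINT x|M. f x * g x))\<^sup>2 \<le> (LINT x|M. (cmod (f x))\<^sup>2) * (LINT x|M. (cmod (g x))\<^sup>2)"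
proof (cases "integrable M (\<lambda>x. f x * g x)")
  case True
  have "ennreal (cmod (LINT x|M. f x * g x)) \<le> (\<integral>\<^sup>+x. ennreal (cmod (f x)) * ennreal (cmod (g x)) \<partial>M)"
    using integral_norm_bound_ennreal[OF True] by (simp add: norm_mult ennreal_mult)
  then have "(ennreal (cmod (LINT x|M. f x * g x)))\<^sup>2 \<le> (\<integral>\<^sup>+x. ennreal (cmod (f x)) * ennreal (cmod (g x)) \<partial>M)\<^sup>2"
    by (rule power_mono) simp
  also have "\<dots> \<le> (\<integral>\<^sup>+x. (ennreal (cmod (f x)))\<^sup>2 \<partial>M) * (\<integral>\<^sup>+x. (ennreal (cmod (g x)))\<^sup>2 \<partial>M)"
    by (rule Cauchy_Schwarz_nn_integral) measurable
  also have "\<dots> = ennreal (LINT x|M. (cmod (f x))\<^sup>2) * ennreal (LINT x|M. (cmod (g x))\<^sup>2)"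
    using f g by (simp add: ennreal_power nn_integral_eq_integral)
  finally show ?thesis
    by (simp add: ennreal_power flip: ennreal_mult'')
next
  case False
  then show ?thesis
    by (auto simp: not_integrable_integral_eq intro!: mult_nonneg_nonneg integral_nonneg_AE)
qed

lemma coef_sq_le:
  assumes "random_function M X" "\<omega> \<in> space M" "finite F"
  shows "(\<Sum>k\<in>F. (cmod (l2inner (cpx (X \<omega>)) (fourier k)))\<^sup>2) \<le> (l2norm (X \<omega>))\<^sup>2"
  using bessel_inequality[of "cpx (X \<omega>)" F] assms
  by (simp add: random_function_def cpx_in_L2 l2norm_cpx)

lemma integrable_coef_sq:
  assumes X: "random_function M X" and int: "integrable M (\<lambda>\<omega>. (l2norm (X \<omega>))\<^sup>2)"
  shows "integrable M (\<lambda>\<omega>. (cmod (l2inner (cpx (X \<omega>)) (fourier k)))\<^sup>2)"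
proof (rule Bochner_Integration.integrable_bound[OF int])
  note [measurable] = measurable_coef[OF X]
  show "(\<lambda>\<omega>. (cmod (l2inner (cpx (X \<omega>)) (fourier k)))\<^sup>2) \<in> borel_measurable M" by measurable
  show "AE \<omega> in M. norm ((cmod (l2inner (cpx (X \<omega>)) (fourier k)))\<^sup>2) \<le> norm ((l2norm (X \<omega>))\<^sup>2)"
    using coef_sq_le[OF X, of _ "{k}"] by simp
qed

lemma coef_mean_zero:
  assumes "prob_space M" and X: "random_function M X" and c: "centered_sq_int M X"
  shows "(LINT \<omega>|M. l2inner (cpx (X \<omega>)) (fourier k)) = 0"
proof -
  interpret prob_space M by fact
  interpret P: pair_sigma_finite M leb01 ..
  have [measurable]: "case_prod X \<in> borel_measurable (M \<Otimes>\<^sub>M leb01)"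
    using X by (simp add: random_function_def)
  have [measurable]: "(\<lambda>x. fourier k (snd x)) \<in> borel_measurable (M \<Otimes>\<^sub>M leb01)"
    by (rule measurable_compose[OF measurable_snd borel_measurable_leb01]) measurable
  let ?f = "\<lambda>\<omega> t. complex_of_real (X \<omega> t) * cnj (fourier k t)"
  have L2: "X \<omega> \<in> L2" if "\<omega> \<in> space M" for \<omega>
    using X that by (simp add: random_function_def)
  have le: "\<bar>x\<bar> \<le> 1 + x\<^sup>2" for x :: real
    using sum_squares_bound[of 1 "\<bar>x\<bar>"] by simp
  have int1: "integrable leb01 (\<lambda>t. \<bar>X \<omega> t\<bar>)" if "\<omega> \<in> space M" for \<omega>
  proof (rule Bochner_Integration.integrable_bound)
    show "integrable leb01 (\<lambda>t. 1 + (norm (X \<omega> t))\<^sup>2)" using L2D(2)[OF L2[OF that]] by simp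
    show "(\<lambda>t. \<bar>X \<omega> t\<bar>) \<in> borel_measurable leb01" using L2D(1)[OF L2[OF that]] by measurable
  qed (use le in auto)
  have "integrable (M \<Otimes>\<^sub>M leb01) (case_prod ?f)"
  proof (rule P.Fubini_integrable)
    show "case_prod ?f \<in> borel_measurable (M \<Otimes>\<^sub>M leb01)" by measurable
    have "integrable M (\<lambda>\<omega>. LINT t|leb01. \<bar>X \<omega> t\<bar>)"
    proof (rule Bochner_Integration.integrable_bound)
      show "integrable M (\<lambda>\<omega>. 1 + (l2norm (X \<omega>))\<^sup>2)"
        using c by (simp add: centered_sq_int_def)
      show "(\<lambda>\<omega>. LINT t|leb01. \<bar>X \<omega> t\<bar>) \<in> borel_measurable M" by measurable
      have "(LINT t|leb01. \<bar>X \<omega> t\<bar>) \<le> 1 + (l2norm (X \<omega>))\<^sup>2" if w: "\<omega> \<in> space M" for \<omega>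
      proof -
        have "(LINT t|leb01. \<bar>X \<omega> t\<bar>) \<le> (LINT t|leb01. 1 + (norm (X \<omega> t))\<^sup>2)"
          using int1[OF w] L2D(2)[OF L2[OF w]] le by (intro integral_mono) auto
        also have "\<dots> = 1 + (l2norm (X \<omega>))\<^sup>2"
          using L2D(2)[OF L2[OF w]] leb01.prob_space by (simp add: l2norm_sq)
        finally show ?thesis .
      qed
      then show "AE \<omega> in M. norm (LINT t|leb01. \<bar>X \<omega> t\<bar>) \<le> norm (1 + (l2norm (X \<omega>))\<^sup>2)"
        by (auto simp: integral_nonneg_AE)
    qed
    then show "integrable M (\<lambda>\<omega>. LINT t|leb01. norm (case (\<omega>, t) of (\<omega>, t) \<Rightarrow> ?f \<omega> t))"
      by (simp add: norm_mult)
    show "AE \<omega> in M. integrable leb01 (\<lambda>t. case (\<omega>, t) of (\<omega>, t) \<Rightarrow> ?f \<omega> t)"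
      using integrable_L2_mult[OF cpx_in_L2[OF L2] fourier_in_L2] by simp
  qed
  then have "(LINT \<omega>|M. l2inner (cpx (X \<omega>)) (fourier k)) = (LINT t|leb01. LINT \<omega>|M. ?f \<omega> t)"
    unfolding l2inner_def by (rule P.Fubini_integral[symmetric])
  also have "\<dots> = (LINT t|leb01. 0)"
  proof (rule Bochner_Integration.integral_cong[OF refl])
    fix t assume "t \<in> space leb01"
    then have "(LINT \<omega>|M. X \<omega> t) = 0" using c by (simp add: centered_sq_int_def)
    then show "(LINT \<omega>|M. ?f \<omega> t) = 0" by simp
  qed
  finally show ?thesis by simp
qed

lemma var_coef_centered:
  assumes "prob_space M" "random_function M X" "centered_sq_int M X"
  shows "var_coef M X k = (LINT \<omega>|M. (cmod (l2inner (cpx (X \<omega>)) (fourier k)))\<^sup>2)"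
  unfolding var_coef_def coef_mean_zero[OF assms] by simp

lemma sum_lam_le:
  assumes st: "stationary_pair M X W" and "finite F"
  shows "(\<Sum>k\<in>F. lam M X W k) \<le> (LINT \<omega>|M. (l2norm (X \<omega>))\<^sup>2)"
proof -
  have p: "prob_space M" and X: "random_function M X" "centered_sq_int M X"
    and W: "random_function M W" "centered_sq_int M W"
    using st by (auto simp: stationary_pair_def)
  have iX: "integrable M (\<lambda>\<omega>. (l2norm (X \<omega>))\<^sup>2)" and iW: "integrable M (\<lambda>\<omega>. (l2norm (W \<omega>))\<^sup>2)"
    using X W by (auto simp: centered_sq_int_def)
  note cX = integrable_coef_sq[OF X(1) iX] and cW = integrable_coef_sq[OF W(1) iW]
  have "lam M X W k \<le> (LINT \<omega>|M. (cmod (l2inner (cpx (X \<omega>)) (fourier k)))\<^sup>2)" for k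
  proof -
    have m: "(\<lambda>\<omega>. l2inner (fourier k) (cpx (X \<omega>))) \<in> borel_measurable M"
      unfolding l2inner_swap[of "fourier k"] using measurable_coef[OF X(1)] by measurable
    have n: "cmod (l2inner (fourier k) (cpx (X \<omega>))) = cmod (l2inner (cpx (X \<omega>)) (fourier k))" for \<omega>
      unfolding l2inner_swap[of "fourier k"] by (rule complex_mod_cnj)
    have "(cmod (cross_coef M X W k))\<^sup>2 \<le>
        (LINT \<omega>|M. (cmod (l2inner (cpx (X \<omega>)) (fourier k)))\<^sup>2) * var_coef M W k"
      unfolding cross_coef_def var_coef_centered[OF p W]
      using cauchy_schwarz_integral[OF m measurable_coef[OF W(1)], of k] cX cW by (simp add: n)
    moreover have "0 \<le> var_coef M W k" "0 \<le> (LINT \<omega>|M. (cmod (l2inner (cpx (X \<omega>)) (fourier k)))\<^sup>2)"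
      unfolding var_coef_def by (auto intro!: integral_nonneg_AE)
    ultimately show ?thesis
      unfolding lam_def by (cases "var_coef M W k = 0") (auto simp: divide_le_eq)
  qed
  then have "(\<Sum>k\<in>F. lam M X W k) \<le> (\<Sum>k\<in>F. (LINT \<omega>|M. (cmod (l2inner (cpx (X \<omega>)) (fourier k)))\<^sup>2))"
    by (intro sum_mono)
  also have "\<dots> = (LINT \<omega>|M. (\<Sum>k\<in>F. (cmod (l2inner (cpx (X \<omega>)) (fourier k)))\<^sup>2))"
    using cX by (intro Bochner_Integration.integral_sum[symmetric])
  also have "\<dots> \<le> (LINT \<omega>|M. (l2norm (X \<omega>))\<^sup>2)"
    using cX iX coef_sq_le[OF X(1)] assms(2) by (intro integral_mono Bochner_Integration.integrable_sum) auto
  finally show ?thesis .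
qed

lemma lam_minus: "lam M X W (- k) = lam M X W k"
proof -
  have 1: "l2inner (cpx Z) (fourier (- k)) = cnj (l2inner (cpx Z) (fourier k))" for Z
    unfolding l2inner_def Bochner_Integration.integral_cnj[symmetric] by (simp add: cnj_fourier)
  have 2: "l2inner (fourier (- k)) (cpx Z) = cnj (l2inner (fourier k) (cpx Z))" for Z
    unfolding l2inner_def Bochner_Integration.integral_cnj[symmetric] by (simp add: cnj_fourier)
  have "cross_coef M X W (- k) = cnj (cross_coef M X W k)"
    unfolding cross_coef_def 1 2 Bochner_Integration.integral_cnj[symmetric] by simp
  moreover have "var_coef M W (- k) = var_coef M W k"
    unfolding var_coef_def 1 Bochner_Integration.integral_cnj
    by (simp flip: complex_cnj_diff)
  ultimately show ?thesis by (simp add: lam_def)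
qed

subsection \<open>A random shift model\<close>

text \<open>A centered function of a uniform variable that equals \<open>1\<close> except with probability
  \<open>q\<close>; \<open>skew (1/2)\<close> is a fair random sign.\<close>

definition skew :: "real \<Rightarrow> real \<Rightarrow> real" where
  "skew q x = 1 - indicator {..<q} x / q"

lemma measurable_skew [measurable]: "skew q \<in> borel_measurable borel"
  unfolding skew_def by measurable

lemma skew_half_sq [simp]: "skew (1/2) x * skew (1/2) x = 1" "\<bar>skew (1/2) x\<bar> = 1"
  by (auto simp: skew_def indicator_def)

lemma abs_skew_le: "0 < q \<Longrightarrow> q \<le> 1 \<Longrightarrow> \<bar>skew q x\<bar> \<le> 1 / q"
  by (auto simp: skew_def indicator_def field_simps)

lemma integrable_skew: "0 < q \<Longrightarrow> q \<le> 1 \<Longrightarrow> integrable leb01 (skew q)"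
  using abs_skew_le by (intro integrable_bounded_leb01[where B = "1 / q"]) auto

lemma integral_skew:
  assumes "0 < q" "q \<le> 1"
  shows "(LINT x|leb01. skew q x) = 0"
proof -
  have "measure leb01 ({..<q} \<inter> {0..1}) = measure lborel ({..<q} \<inter> {0..1})"
    by (rule measure_restrict_space) auto
  also have "{..<q} \<inter> {0..1} = {0..<q}" using assms by auto
  finally have m: "measure leb01 {0..<q} = q" using assms by (simp add: \<open>{..<q} \<inter> {0..1} = {0..<q}\<close>)
  have int: "integrable leb01 (indicator {..<q} :: real \<Rightarrow> real)"
    by (rule integrable_bounded_leb01[where B = 1]) (auto simp: indicator_def)
  have "(LINT x|leb01. indicator {..<q} x) = (LINT x|leb01. indicator {0..<q} x :: real)"
    by (intro Bochner_Integration.integral_cong) (auto simp: indicator_def)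
  also have "\<dots> = q"
    using assms m by (simp add: Int_absorb2 subset_iff)
  finally show ?thesis
    using assms int leb01.prob_space by (simp add: skew_def)
qed

interpretation cube: product_prob_space "\<lambda>_::nat. leb01" "{..<4}"
  by unfold_locales

abbreviation cube4 :: "(nat \<Rightarrow> real) measure" where
  "cube4 \<equiv> PiM {..<4} (\<lambda>_. leb01)"

lemma prob_space_cube4: "prob_space cube4"
  by (rule cube.prob_space_axioms)

lemma measure_cube4 [simp]: "measure cube4 (space cube4) = 1" "emeasure cube4 (space cube4) = 1"
  by (rule prob_space.prob_space[OF prob_space_cube4] prob_space.emeasure_space_1[OF prob_space_cube4])+

lemma measurable_cube4_component:
  assumes "f \<in> borel_measurable leb01" "i < 4"
  shows "(\<lambda>\<omega>. f (\<omega> i)) \<in> borel_measurable cube4"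
  using measurable_component_singleton[of i "{..<4}" "\<lambda>_. leb01"] assms by (auto intro: measurable_compose)

lemma measurable_cube4_nth: "i < 4 \<Longrightarrow> (\<lambda>\<omega>. \<omega> i) \<in> borel_measurable cube4"
  using measurable_cube4_component[of "\<lambda>x. x" i] by simp

lemma integrable_bounded_cube4:
  fixes f :: "(nat \<Rightarrow> real) \<Rightarrow> real"
  assumes "f \<in> borel_measurable cube4" "\<And>t. \<bar>f t\<bar> \<le> B"
  shows "integrable cube4 f"
  using assms by (intro cube.integrable_const_bound[where B = B]) auto

lemma integral_cube4_prod:
  fixes f0 f1 f2 f3 :: "real \<Rightarrow> 'b::{real_normed_field, banach, second_countable_topology}"
  assumes "integrable leb01 f0" "integrable leb01 f1" "integrable leb01 f2" "integrable leb01 f3"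
  shows "(LINT \<omega>|cube4. f0 (\<omega> 0) * f1 (\<omega> 1) * f2 (\<omega> 2) * f3 (\<omega> 3)) =
    (LINT x|leb01. f0 x) * (LINT x|leb01. f1 x) * (LINT x|leb01. f2 x) * (LINT x|leb01. f3 x)"
proof -
  define f where "f i = [f0, f1, f2, f3] ! i" for i
  have 4: "(\<Prod>i<4. h i) = h 0 * h 1 * h 2 * h 3" for h :: "nat \<Rightarrow> 'b"
    by (simp add: eval_nat_numeral)
  have "(LINT \<omega>|cube4. (\<Prod>i<4. f i (\<omega> i))) = (\<Prod>i<4. LINT x|leb01. f i x)"
  proof (rule cube.product_integral_prod)
    show "integrable leb01 (f i)" if "i \<in> {..<4}" for i
    proof -
      have "i \<in> {0, 1, 2, 3}" using that by auto
      then show ?thesis using assms by (auto simp: f_def)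
    qed
  qed simp
  then show ?thesis unfolding 4 by (simp add: f_def)
qed

text \<open>Coordinate \<open>0\<close> is the random shift and coordinate \<open>1\<close> an independent sign, which
  makes the process centered. All Fourier coefficients then have deterministic modulus \<open>\<bar>g k\<bar>\<close>, so
  every normalized moment is \<open>1\<close>. The process serves both as \<open>X\<close> and as \<open>W\<close>.\<close>

definition random_shift :: "(int \<Rightarrow> real) \<Rightarrow> (nat \<Rightarrow> real) \<Rightarrow> real \<Rightarrow> real" where
  "random_shift g \<omega> t = skew (1/2) (\<omega> 1) * cos_series g (t - \<omega> 0)"

context sym_summable
begin

abbreviation "sup_g \<equiv> (LINT k|count_space UNIV. \<bar>g k\<bar>)"

lemma random_shift_bound: "\<bar>random_shift g \<omega> t\<bar> \<le> sup_g"
  using cos_series_bound by (simp add: random_shift_def abs_mult)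

lemma measurable_random_shift:
  "case_prod (random_shift g) \<in> borel_measurable (cube4 \<Otimes>\<^sub>M leb01)"
proof -
  have [measurable]: "(\<lambda>x. fst x i) \<in> borel_measurable (cube4 \<Otimes>\<^sub>M leb01)" if "i < 4" for i
    using that by (intro measurable_compose[OF measurable_fst] measurable_cube4_nth)
  have [measurable]: "snd \<in> borel_measurable (cube4 \<Otimes>\<^sub>M leb01)"
    by (rule measurable_compose[OF measurable_snd borel_measurable_leb01]) simp
  show ?thesis unfolding random_shift_def by measurable
qed

lemma random_shift_measurable_at: "(\<lambda>\<omega>. random_shift g \<omega> t) \<in> borel_measurable cube4"
proof -
  note [measurable] = measurable_cube4_nth
  show ?thesis unfolding random_shift_def by measurable
qed

lemma random_shift_in_L2: "random_shift g \<omega> \<in> L2"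
proof (rule bounded_in_L2)
  show "random_shift g \<omega> \<in> borel_measurable leb01" unfolding random_shift_def by measurable
qed (use random_shift_bound in simp)

lemma random_function_shift: "random_function cube4 (random_shift g)"
  using measurable_random_shift random_shift_in_L2 by (simp add: random_function_def)

lemma random_shift_prod:
  "random_shift g \<omega> t * random_shift g \<omega> s = cos_series g (t - \<omega> 0) * cos_series g (s - \<omega> 0)"
proof -
  have "random_shift g \<omega> t * random_shift g \<omega> s =
      (skew (1/2) (\<omega> 1) * skew (1/2) (\<omega> 1)) * (cos_series g (t - \<omega> 0) * cos_series g (s - \<omega> 0))"
    by (simp only: random_shift_def mult_ac)
  then show ?thesis by simp
qed

lemma integrable_cos_series: "integrable leb01 (\<lambda>v. cos_series g (t - v))"
  using cos_series_bound by (intro integrable_bounded_leb01[where B = sup_g]) auto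

lemma random_shift_mean: "(LINT \<omega>|cube4. random_shift g \<omega> t) = 0"
  using integral_cube4_prod[OF integrable_cos_series integrable_skew[of "1/2"], of "\<lambda>_. 1" "\<lambda>_. 1" t]
  by (simp add: integral_skew random_shift_def mult.commute)

lemma random_shift_second_moment:
  "(LINT \<omega>|cube4. random_shift g \<omega> t * random_shift g \<omega> s) = cos_series (\<lambda>k. (g k)\<^sup>2) (s - t)"
proof -
  have "integrable leb01 (\<lambda>v. cos_series g (t - v) * cos_series g (s - v))"
    using cos_series_bound
    by (intro integrable_bounded_leb01[where B = "sup_g * sup_g"])
       (auto simp: abs_mult intro!: mult_mono order_trans[OF abs_ge_zero])
  from integral_cube4_prod[OF this, of "\<lambda>_. 1" "\<lambda>_. 1" "\<lambda>_. 1"]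
  show ?thesis
    using leb01.prob_space by (simp add: random_shift_prod autocorrelation_cos_series)
qed

lemma cov_random_shift:
  "cov cube4 (\<lambda>\<omega>. random_shift g \<omega> t) (\<lambda>\<omega>. random_shift g \<omega> s) = cos_series (\<lambda>k. (g k)\<^sup>2) (s - t)"
  unfolding cov_def random_shift_mean using random_shift_second_moment by simp

lemma l2norm_random_shift: "(l2norm (random_shift g \<omega>))\<^sup>2 = (LINT k|count_space UNIV. (g k)\<^sup>2)"
proof -
  have "(l2norm (random_shift g \<omega>))\<^sup>2 = (LINT t|leb01. cos_series g (\<omega> 0 - t) * cos_series g (\<omega> 0 - t))"
    unfolding l2norm_sq using cos_series_minus[of g "_ - _"]
    by (simp add: power2_eq_square random_shift_prod)
  then show ?thesis
    unfolding autocorrelation_cos_series by (simp add: cos_series_def)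
qed

lemma centered_random_shift: "centered_sq_int cube4 (random_shift g)"
proof -
  have "integrable cube4 (\<lambda>\<omega>. (random_shift g \<omega> t)\<^sup>2)" for t
  proof (rule integrable_bounded_cube4)
    show "(\<lambda>\<omega>. (random_shift g \<omega> t)\<^sup>2) \<in> borel_measurable cube4"
      using random_shift_measurable_at by measurable
    show "\<bar>(random_shift g \<omega> t)\<^sup>2\<bar> \<le> sup_g\<^sup>2" for \<omega>
      using power_mono[OF random_shift_bound[of \<omega> t], of 2] by simp
  qed
  then show ?thesis
    using random_shift_measurable_at random_shift_mean
    by (simp add: centered_sq_int_def l2norm_random_shift)
qed

lemma coef_random_shift:
  "l2inner (cpx (random_shift g \<omega>)) (fourier k) =
     of_real (skew (1/2) (\<omega> 1)) * of_real (g k) * fourier (- k) (\<omega> 0)"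
proof -
  have "l2inner (cpx (random_shift g \<omega>)) (fourier k) =
      (LINT t|leb01. of_real (skew (1/2) (\<omega> 1)) * (fourier (- k) t * cos_series g (\<omega> 0 - t)))"
    unfolding l2inner_def using cos_series_minus[of g "\<omega> 0 - _"]
    by (intro Bochner_Integration.integral_cong) (simp_all add: random_shift_def cnj_fourier)
  also have "\<dots> = of_real (skew (1/2) (\<omega> 1)) * (LINT t|leb01. fourier (- k) t * cos_series g (\<omega> 0 - t))"
    by (rule integral_mult_right_zero)
  finally show ?thesis by (simp add: fourier_cos_series sym)
qed

lemma norm_coef_random_shift: "cmod (l2inner (cpx (random_shift g \<omega>)) (fourier k)) = \<bar>g k\<bar>"
  by (simp add: coef_random_shift norm_mult)

lemma var_coef_random_shift: "var_coef cube4 (random_shift g) k = (g k)\<^sup>2"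
  by (simp add: var_coef_centered[OF prob_space_cube4 random_function_shift centered_random_shift]
      norm_coef_random_shift)

lemma cross_coef_random_shift:
  "cross_coef cube4 (random_shift g) (random_shift g) k = of_real ((g k)\<^sup>2)"
  unfolding cross_coef_def l2inner_swap[of "fourier k"]
  by (simp add: mult.commute complex_norm_square[symmetric] norm_coef_random_shift flip: of_real_power)

lemma lam_random_shift: "lam cube4 (random_shift g) (random_shift g) k = (g k)\<^sup>2"
  unfolding lam_def cross_coef_random_shift var_coef_random_shift norm_of_real
  by (simp add: power2_eq_square)

lemma stationary_random_shift:
  assumes "\<And>k. g k \<noteq> 0"
  shows "stationary_pair cube4 (random_shift g) (random_shift g)"
proof -
  interpret sq: sym_summable "\<lambda>k. (g k)\<^sup>2" by (rule sq_summable)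
  have "cross_cov_op cube4 (random_shift g) (random_shift g) (fourier k) s =
      cross_coef cube4 (random_shift g) (random_shift g) k * fourier k s" for k s
    unfolding cross_cov_op_def cov_random_shift cross_coef_random_shift
    by (rule sq.fourier_cos_series)
  then show ?thesis
    unfolding stationary_pair_def
    using prob_space_cube4 random_function_shift centered_random_shift assms
    by (intro conjI exI[of _ "cos_series (\<lambda>k. (g k)\<^sup>2)"])
       (auto simp: cross_coef_random_shift cov_random_shift)
qed

lemma coef_moment_random_shift:
  assumes "\<And>k. g k \<noteq> 0"
  shows "coef_moment cube4 (random_shift g) m = 1"
proof -
  have "cmod (l2inner (cpx (random_shift g \<omega>)) (fourier k) / of_real (sqrt (var_coef cube4 (random_shift g) k))) = 1"
    for \<omega> k
    using assms[of k] by (simp add: norm_divide norm_coef_random_shift var_coef_random_shift)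
  then show ?thesis
    unfolding coef_moment_def by simp
qed

lemma random_shift_in_F_moment:
  assumes "\<And>k. g k \<noteq> 0" "1 \<le> \<eta>" "1 \<le> \<tau>"
  shows "(cube4, random_shift g, random_shift g) \<in> F_moment m \<eta> \<tau>"
  using assms ennreal_leI[of 1]
  by (auto simp: F_moment_def stationary_random_shift coef_moment_random_shift
      lam_random_shift var_coef_random_shift)

lemma random_shift_in_F_link:
  assumes "\<And>k. g k \<noteq> 0" "1 \<le> \<eta>" "1 \<le> \<tau>" "(\<lambda>k. (g k)\<^sup>2) \<in> link_class \<kappa> d \<nu> p"
    and "(LINT k|count_space UNIV. (g k)\<^sup>2) \<le> \<Lambda>"
  shows "(cube4, random_shift g, random_shift g) \<in> F_link \<kappa> d \<nu> p m \<eta> \<tau> \<Lambda>"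
  using assms random_shift_in_F_moment
  by (simp add: F_link_def l2norm_random_shift lam_random_shift[abs_def])

end

subsection \<open>Two-point lower bound\<close>

lemma gam_pos: "0 < gam k"
  by (simp add: gam_def add_pos_nonneg)

lemma sobnorm_sq_ge_term:
  "ennreal (gam k powr \<nu> * (cmod (l2inner f (fourier k)))\<^sup>2) \<le> sobnorm_sq \<nu> f"
proof -
  let ?h = "\<lambda>k. ennreal (gam k powr \<nu> * (cmod (l2inner f (fourier k)))\<^sup>2)"
  have "?h k = sum ?h {k}" by simp
  also have "\<dots> \<le> (SUP F\<in>{F. finite F \<and> F \<subseteq> UNIV}. sum ?h F)"
    by (rule SUP_upper) simp
  also have "\<dots> = sobnorm_sq \<nu> f"
    unfolding sobnorm_sq_def by (rule nonneg_infsum_complete[symmetric]) simp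
  finally show ?thesis .
qed

lemma measurable_response:
  assumes X: "random_function M X" and [measurable]: "\<beta> \<in> borel_measurable leb01" "U \<in> borel_measurable M"
  shows "response \<sigma> \<beta> X U \<in> borel_measurable M"
proof -
  have [measurable]: "case_prod X \<in> borel_measurable (M \<Otimes>\<^sub>M leb01)"
    using X by (simp add: random_function_def)
  have [measurable]: "(\<lambda>x. \<beta> (snd x)) \<in> borel_measurable (M \<Otimes>\<^sub>M leb01)"
    by (rule measurable_compose[OF measurable_snd]) measurable
  show ?thesis unfolding response_def by measurable
qed

text \<open>Le Cam's two-point method by coupling: where the two samples agree, so do the estimates, and no
  single value is close to both \<open>\<beta>\<close> and \<open>-\<beta>\<close>.\<close>

lemma two_point_risk:
  fixes M :: "'w measure"
  assumes est: "est \<in> estimators n" and "prob_space M"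
    and X: "random_function M X" and W: "random_function M W"
    and U: "U1 \<in> borel_measurable M" "U2 \<in> borel_measurable M" and \<beta>: "\<beta> \<in> L2"
    and A: "A \<in> sets M" "1 - q \<le> measure M A" "q \<le> 1"
    and eq: "\<And>\<omega>. \<omega> \<in> A \<Longrightarrow> response \<sigma> \<beta> X U1 \<omega> = response \<sigma> (\<lambda>t. - \<beta> t) X U2 \<omega>"
  shows "ennreal (2 * gam k powr \<nu> * (cmod (l2inner (cpx \<beta>) (fourier k)))\<^sup>2 * (1 - real n * q))
    \<le> risk \<sigma> \<nu> n est \<beta> M X W U1 + risk \<sigma> \<nu> n est (\<lambda>t. - \<beta> t) M X W U2"
proof -
  interpret prob_space M by fact
  interpret P: product_prob_space "\<lambda>_::nat. M" "{..<n}" by unfold_locales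
  let ?P = "PiM {..<n} (\<lambda>_. M)"
  let ?D = "PiM {..<n} (\<lambda>_. borel \<Otimes>\<^sub>M (L2_borel \<Otimes>\<^sub>M L2_borel)) ::
    (nat \<Rightarrow> real \<times> (real \<Rightarrow> real) \<times> (real \<Rightarrow> real)) measure"
  define b where "b = l2inner (cpx \<beta>) (fourier k)"
  define data where "data \<beta>' U \<omega> = (\<lambda>i\<in>{..<n}. (response \<sigma> \<beta>' X U (\<omega> i), X (\<omega> i), W (\<omega> i)))"
    for \<beta>' U and \<omega> :: "nat \<Rightarrow> 'w"
  define T where "T \<beta>' U \<omega> = gam k powr \<nu> * (cmod (l2inner (est (data \<beta>' U \<omega>)) (fourier k)
      - l2inner (cpx \<beta>') (fourier k)))\<^sup>2" for \<beta>' U \<omega>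
  have est': "est \<in> ?D \<rightarrow>\<^sub>M L2_borel" using est by (simp add: estimators_def)
  have data: "data \<beta>' U \<in> ?P \<rightarrow>\<^sub>M ?D" if "\<beta>' \<in> L2" "U \<in> borel_measurable M" for \<beta>' U
  proof -
    note [measurable] = measurable_response[OF X L2D(1)[OF that(1)] that(2)]
      measurable_random_function[OF X] measurable_random_function[OF W]
    show ?thesis unfolding data_def by measurable
  qed
  have l: "(\<lambda>\<omega>. l2inner (est (data \<beta>' U \<omega>)) (fourier k)) \<in> borel_measurable ?P"
    if "\<beta>' \<in> L2" "U \<in> borel_measurable M" for \<beta>' U
    by (rule measurable_compose[OF data[OF that]], rule measurable_compose[OF est'],
        rule measurable_l2inner[OF fourier_in_L2])
  have T_meas: "(\<lambda>\<omega>. ennreal (T \<beta>' U \<omega>)) \<in> borel_measurable ?P"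
    if "\<beta>' \<in> L2" "U \<in> borel_measurable M" for \<beta>' U
    unfolding T_def using l[OF that] by measurable
  have T_le: "(\<integral>\<^sup>+\<omega>. ennreal (T \<beta>' U \<omega>) \<partial>?P) \<le> risk \<sigma> \<nu> n est \<beta>' M X W U"
    if "\<beta>' \<in> L2" "U \<in> borel_measurable M" for \<beta>' U
    unfolding risk_def
  proof (rule nn_integral_mono)
    fix \<omega> assume "\<omega> \<in> space ?P"
    then have "est (data \<beta>' U \<omega>) \<in> L2"
      using measurable_space[OF est' measurable_space[OF data[OF that]]] by simp
    from l2inner_diff_left[OF this cpx_in_L2[OF that(1)] fourier_in_L2[of k]]
      sobnorm_sq_ge_term[of k \<nu> "\<lambda>t. est (data \<beta>' U \<omega>) t - of_real (\<beta>' t)"]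
    show "ennreal (T \<beta>' U \<omega>) \<le> sobnorm_sq \<nu> (\<lambda>t. est (\<lambda>i\<in>{..<n}.
        (response \<sigma> \<beta>' X U (\<omega> i), X (\<omega> i), W (\<omega> i))) t - of_real (\<beta>' t))"
      by (simp add: T_def data_def)
  qed
  have \<beta>': "(\<lambda>t. - \<beta> t) \<in> L2" using \<beta> by (simp add: L2_def)
  define N where "N = PiE {..<n} (\<lambda>_. A)"
  define c where "c = 2 * gam k powr \<nu> * (cmod b)\<^sup>2"
  have c: "0 \<le> c" by (simp add: c_def)
  have N: "N \<in> sets ?P" unfolding N_def using A by (intro sets_PiM_I_finite) auto
  have "1 - real n * q \<le> (1 - q) ^ n"
    using Bernoulli_inequality[of "- q" n] A by simp
  also have "\<dots> \<le> measure M A ^ n" using A by (intro power_mono) auto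
  finally have "ennreal (1 - real n * q) \<le> ennreal (measure M A ^ n)" by (rule ennreal_leI)
  also have "\<dots> = emeasure ?P N"
    unfolding N_def using A by (subst P.emeasure_PiM) (auto simp: emeasure_eq_measure ennreal_power)
  finally have N_ge: "ennreal (1 - real n * q) \<le> emeasure ?P N" .
  have T_sum: "ennreal c * indicator N \<omega> \<le> ennreal (T \<beta> U1 \<omega>) + ennreal (T (\<lambda>t. - \<beta> t) U2 \<omega>)" for \<omega>
  proof (cases "\<omega> \<in> N")
    case True
    then have "data (\<lambda>t. - \<beta> t) U2 \<omega> = data \<beta> U1 \<omega>"
      unfolding data_def N_def using eq by (intro restrict_ext) (auto simp: PiE_def Pi_def)
    moreover have "l2inner (cpx (\<lambda>t. - \<beta> t)) (fourier k) = - b"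
      by (simp add: b_def l2inner_def)
    moreover have "2 * (cmod b)\<^sup>2 \<le> (cmod (x - b))\<^sup>2 + (cmod (x + b))\<^sup>2" for x
      unfolding cmod_power2 by (simp add: power2_diff power2_sum)
    then have "gam k powr \<nu> * (2 * (cmod b)\<^sup>2) \<le> gam k powr \<nu> * ((cmod (x - b))\<^sup>2 + (cmod (x + b))\<^sup>2)" for x
      by (intro mult_left_mono) auto
    ultimately have "c \<le> T \<beta> U1 \<omega> + T (\<lambda>t. - \<beta> t) U2 \<omega>"
      by (simp add: T_def c_def b_def[symmetric] distrib_left mult_ac)
    then show ?thesis
      using True by (simp add: T_def flip: ennreal_plus)
  qed simp
  have "ennreal (c * (1 - real n * q)) \<le> ennreal c * emeasure ?P N"
    using N_ge c by (simp add: ennreal_mult' mult_left_mono)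
  also have "\<dots> = (\<integral>\<^sup>+\<omega>. ennreal c * indicator N \<omega> \<partial>?P)"
    using N by (simp add: nn_integral_cmult_indicator)
  also have "\<dots> \<le> (\<integral>\<^sup>+\<omega>. ennreal (T \<beta> U1 \<omega>) + ennreal (T (\<lambda>t. - \<beta> t) U2 \<omega>) \<partial>?P)"
    by (intro nn_integral_mono T_sum)
  also have "\<dots> = (\<integral>\<^sup>+\<omega>. ennreal (T \<beta> U1 \<omega>) \<partial>?P) + (\<integral>\<^sup>+\<omega>. ennreal (T (\<lambda>t. - \<beta> t) U2 \<omega>) \<partial>?P)"
    using T_meas \<beta> \<beta>' U by (intro nn_integral_add) auto
  also have "\<dots> \<le> risk \<sigma> \<nu> n est \<beta> M X W U1 + risk \<sigma> \<nu> n est (\<lambda>t. - \<beta> t) M X W U2"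
    using \<beta> \<beta>' U by (intro add_mono T_le)
  finally show ?thesis by (simp add: c_def b_def)
qed

text \<open>For \<open>A = 2 b g\<^sub>k / \<sigma>\<close> the product of all factors but the last is \<open>\<langle>\<beta>, X\<rangle> / \<sigma>\<close>. Unless coordinate \<open>2\<close>
  is below \<open>q\<close>, the noise removes the signal from the response exactly; the skewness on the rare event
  restores \<open>E[U W(t)] = 0\<close>.\<close>

definition perturbation :: "real \<Rightarrow> real \<Rightarrow> int \<Rightarrow> (nat \<Rightarrow> real) \<Rightarrow> real" where
  "perturbation A q k \<omega> = A * cos (2 * pi * of_int k * \<omega> 0) * skew (1/2) (\<omega> 1) * skew q (\<omega> 2)"

definition noise_scale :: "real \<Rightarrow> real \<Rightarrow> int \<Rightarrow> real" where
  "noise_scale A q k = sqrt (1 - (LINT \<omega>|cube4. (perturbation A q k \<omega>)\<^sup>2))"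

definition noise :: "real \<Rightarrow> real \<Rightarrow> int \<Rightarrow> real \<Rightarrow> (nat \<Rightarrow> real) \<Rightarrow> real" where
  "noise A q k s \<omega> = noise_scale A q k * skew (1/2) (\<omega> 3) - s * perturbation A q k \<omega>"

lemma measurable_perturbation [measurable]: "perturbation A q k \<in> borel_measurable cube4"
proof -
  note [measurable] = measurable_cube4_nth
  show ?thesis unfolding perturbation_def by measurable
qed

lemma measurable_noise [measurable]: "noise A q k s \<in> borel_measurable cube4"
proof -
  note [measurable] = measurable_cube4_nth
  show ?thesis unfolding noise_def by measurable
qed

locale perturbed_noise =
  fixes A q s :: real and k :: int
  assumes q: "0 < q" "q \<le> 1" and A: "\<bar>A\<bar> \<le> q" and s: "s = 1 \<or> s = - 1"
begin

lemma perturbation_bound: "\<bar>perturbation A q k \<omega>\<bar> \<le> 1"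
proof -
  have "\<bar>perturbation A q k \<omega>\<bar> \<le> q * 1 * 1 * (1 / q)"
    unfolding perturbation_def abs_mult using A q abs_skew_le[OF q]
    by (intro mult_mono) auto
  then show ?thesis using q by simp
qed

lemma integrable_factors:
  "integrable leb01 (\<lambda>v. A * cos (2 * pi * of_int k * v))" "integrable leb01 (skew (1/2))"
  "integrable leb01 (skew q)" "integrable leb01 (\<lambda>_. 1 :: real)"
proof -
  show "integrable leb01 (\<lambda>v. A * cos (2 * pi * of_int k * v))"
    using A q by (intro integrable_bounded_leb01[where B = "\<bar>A\<bar>"]) (auto simp: abs_mult mult_left_le)
qed (use q in \<open>auto intro: integrable_skew\<close>)

lemma perturbation_mean: "(LINT \<omega>|cube4. perturbation A q k \<omega>) = 0"
  using integral_cube4_prod[OF integrable_factors(1,2,3,4)]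
  by (simp add: perturbation_def integral_skew[OF q])

lemma skew_mean: "(LINT \<omega>|cube4. skew (1/2) (\<omega> 3)) = 0"
  using integral_cube4_prod[OF integrable_factors(4,4,4,2)] by (simp add: integral_skew)

lemma perturbation_skew: "(LINT \<omega>|cube4. perturbation A q k \<omega> * skew (1/2) (\<omega> 3)) = 0"
  using integral_cube4_prod[OF integrable_factors(1,2,3,2)] by (simp add: perturbation_def integral_skew)

lemma integrable_perturbation:
  "integrable cube4 (perturbation A q k)" "integrable cube4 (\<lambda>\<omega>. (perturbation A q k \<omega>)\<^sup>2)"
  "integrable cube4 (\<lambda>\<omega>. skew (1/2) (\<omega> 3))"
  "integrable cube4 (\<lambda>\<omega>. perturbation A q k \<omega> * skew (1/2) (\<omega> 3))"
proof -
  have m: "(\<lambda>\<omega>. skew (1/2) (\<omega> 3)) \<in> borel_measurable cube4"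
    by (intro measurable_cube4_component) auto
  show "integrable cube4 (perturbation A q k)"
    using perturbation_bound by (intro integrable_bounded_cube4[where B = 1]) auto
  show "integrable cube4 (\<lambda>\<omega>. (perturbation A q k \<omega>)\<^sup>2)"
    using perturbation_bound by (intro integrable_bounded_cube4[where B = 1]) (auto simp: abs_square_le_1)
  show "integrable cube4 (\<lambda>\<omega>. skew (1/2) (\<omega> 3))"
    using m by (intro integrable_bounded_cube4[where B = 1]) auto
  show "integrable cube4 (\<lambda>\<omega>. perturbation A q k \<omega> * skew (1/2) (\<omega> 3))"
    using perturbation_bound m
    by (intro integrable_bounded_cube4[where B = 1] borel_measurable_times) (auto simp: abs_mult)
qed

lemma noise_scale: "0 \<le> noise_scale A q k" "noise_scale A q k \<le> 1"
  "(noise_scale A q k)\<^sup>2 = 1 - (LINT \<omega>|cube4. (perturbation A q k \<omega>)\<^sup>2)"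
proof -
  have "(LINT \<omega>|cube4. (perturbation A q k \<omega>)\<^sup>2) \<le> (LINT \<omega>|cube4. 1)"
    using perturbation_bound integrable_perturbation(2)
    by (intro integral_mono) (auto simp: abs_square_le_1)
  moreover have "0 \<le> (LINT \<omega>|cube4. (perturbation A q k \<omega>)\<^sup>2)"
    by (intro integral_nonneg_AE) simp
  ultimately show "0 \<le> noise_scale A q k" "noise_scale A q k \<le> 1"
    "(noise_scale A q k)\<^sup>2 = 1 - (LINT \<omega>|cube4. (perturbation A q k \<omega>)\<^sup>2)"
    by (auto simp: noise_scale_def)
qed

lemma noise_bound: "\<bar>noise A q k s \<omega>\<bar> \<le> 2"
proof -
  have "\<bar>noise A q k s \<omega>\<bar> \<le> \<bar>noise_scale A q k * skew (1/2) (\<omega> 3)\<bar> + \<bar>s * perturbation A q k \<omega>\<bar>"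
    unfolding noise_def by (rule abs_triangle_ineq4)
  also have "\<dots> \<le> 1 + 1"
    using noise_scale perturbation_bound s by (intro add_mono) (auto simp: abs_mult)
  finally show ?thesis by simp
qed

lemma noise_mean: "(LINT \<omega>|cube4. noise A q k s \<omega>) = 0"
  unfolding noise_def using integrable_perturbation by (simp add: perturbation_mean skew_mean)

lemma noise_variance: "(LINT \<omega>|cube4. (noise A q k s \<omega>)\<^sup>2) = 1"
proof -
  have ss: "s * s = 1" using s by auto
  have sq: "(z * e - r * p)\<^sup>2 = z\<^sup>2 * (e * e) + (r * r) * p\<^sup>2 - 2 * z * r * (p * e)" for z e r p :: real
    by (simp add: power2_eq_square algebra_simps)
  have "(noise A q k s \<omega>)\<^sup>2 = (noise_scale A q k)\<^sup>2 + (perturbation A q k \<omega>)\<^sup>2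
      - 2 * noise_scale A q k * s * (perturbation A q k \<omega> * skew (1/2) (\<omega> 3))" for \<omega>
  proof -
    have "(noise A q k s \<omega>)\<^sup>2 = (noise_scale A q k)\<^sup>2 * (skew (1/2) (\<omega> 3) * skew (1/2) (\<omega> 3))
        + (s * s) * (perturbation A q k \<omega>)\<^sup>2
        - 2 * noise_scale A q k * s * (perturbation A q k \<omega> * skew (1/2) (\<omega> 3))"
      unfolding noise_def using sq[of "noise_scale A q k" _ s] by simp
    then show ?thesis by (simp add: ss)
  qed
  then have "(LINT \<omega>|cube4. (noise A q k s \<omega>)\<^sup>2) = (LINT \<omega>|cube4. (noise_scale A q k)\<^sup>2 + (perturbation A q k \<omega>)\<^sup>2
      - 2 * noise_scale A q k * s * (perturbation A q k \<omega> * skew (1/2) (\<omega> 3)))"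
    by (simp only:)
  also have "\<dots> = (noise_scale A q k)\<^sup>2 + (LINT \<omega>|cube4. (perturbation A q k \<omega>)\<^sup>2)"
    using integrable_perturbation perturbation_skew by (simp del: integral_mult_right)
  finally show ?thesis by (simp only: noise_scale(3))
qed

lemma noise_in_E_moment:
  assumes "2 ^ l \<le> \<eta>"
  shows "noise A q k s \<in> E_moment l \<eta> cube4"
proof -
  have "integrable cube4 (\<lambda>\<omega>. (noise A q k s \<omega>)\<^sup>2)"
    by (rule ccontr) (use noise_variance in \<open>simp add: not_integrable_integral_eq\<close>)
  moreover have "cov cube4 (noise A q k s) (noise A q k s) = 1"
    unfolding cov_def noise_mean using noise_variance by (simp add: power2_eq_square)
  moreover have "(\<integral>\<^sup>+\<omega>. ennreal (\<bar>noise A q k s \<omega>\<bar> ^ l) \<partial>cube4) \<le> (\<integral>\<^sup>+\<omega>. ennreal \<eta> \<partial>cube4)"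
    by (intro nn_integral_mono ennreal_leI order_trans[OF power_mono[OF noise_bound abs_ge_zero] assms])
  ultimately show ?thesis by (simp add: E_moment_def noise_mean)
qed

lemma noise_uncorrelated:
  assumes "sym_summable g"
  shows "(LINT \<omega>|cube4. noise A q k s \<omega> * random_shift g \<omega> t) = 0"
proof -
  interpret sym_summable g by fact
  have i: "integrable leb01 (\<lambda>v. A * cos (2 * pi * of_int k * v) * cos_series g (t - v))"
  proof (rule integrable_bounded_leb01)
    show "norm (A * cos (2 * pi * of_int k * v) * cos_series g (t - v)) \<le> \<bar>A\<bar> * 1 * sup_g" for v
      unfolding real_norm_def abs_mult using cos_series_bound
      by (intro mult_mono) auto
  qed measurable
  have 1: "perturbation A q k \<omega> * random_shift g \<omega> t =
      A * cos (2 * pi * of_int k * \<omega> 0) * cos_series g (t - \<omega> 0) * 1 * skew q (\<omega> 2) * 1" for \<omega>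
  proof -
    have "perturbation A q k \<omega> * random_shift g \<omega> t = A * cos (2 * pi * of_int k * \<omega> 0) * cos_series g (t - \<omega> 0)
        * (skew (1/2) (\<omega> 1) * skew (1/2) (\<omega> 1)) * skew q (\<omega> 2) * 1"
      by (simp only: perturbation_def random_shift_def mult_ac mult_1_right mult_1_left)
    then show ?thesis by simp
  qed
  have P: "(LINT \<omega>|cube4. perturbation A q k \<omega> * random_shift g \<omega> t) = 0"
    unfolding 1 using integral_cube4_prod[OF i integrable_factors(4,3,4)] by (simp add: integral_skew[OF q])
  have 2: "skew (1/2) (\<omega> 3) * random_shift g \<omega> t = cos_series g (t - \<omega> 0) * skew (1/2) (\<omega> 1) * 1 * skew (1/2) (\<omega> 3)" for \<omega>
    by (simp add: random_shift_def)
  have Z: "(LINT \<omega>|cube4. skew (1/2) (\<omega> 3) * random_shift g \<omega> t) = 0"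
    unfolding 2 using integral_cube4_prod[OF integrable_cos_series integrable_factors(2,4,2)]
    by (simp add: integral_skew)
  note [measurable] = random_shift_measurable_at
  have iP: "integrable cube4 (\<lambda>\<omega>. perturbation A q k \<omega> * random_shift g \<omega> t)"
  proof (rule integrable_bounded_cube4)
    show "\<bar>perturbation A q k \<omega> * random_shift g \<omega> t\<bar> \<le> 1 * sup_g" for \<omega>
      unfolding abs_mult by (intro mult_mono perturbation_bound random_shift_bound) auto
  qed measurable
  have iZ: "integrable cube4 (\<lambda>\<omega>. skew (1/2) (\<omega> 3) * random_shift g \<omega> t)"
  proof (rule integrable_bounded_cube4)
    show "\<bar>skew (1/2) (\<omega> 3) * random_shift g \<omega> t\<bar> \<le> sup_g" for \<omega>
      using random_shift_bound by (simp add: abs_mult)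
    show "(\<lambda>\<omega>. skew (1/2) (\<omega> 3) * random_shift g \<omega> t) \<in> borel_measurable cube4"
      by (intro borel_measurable_times measurable_cube4_component random_shift_measurable_at) auto
  qed
  have "(LINT \<omega>|cube4. noise A q k s \<omega> * random_shift g \<omega> t) =
      (LINT \<omega>|cube4. noise_scale A q k * (skew (1/2) (\<omega> 3) * random_shift g \<omega> t)
        - s * (perturbation A q k \<omega> * random_shift g \<omega> t))"
    by (simp only: noise_def left_diff_distrib mult.assoc)
  also have "\<dots> = 0"
    by (subst Bochner_Integration.integral_diff)
       (use iP iZ P Z in \<open>simp_all only: integrable_mult_right integral_mult_right_zero mult_zero_right diff_self\<close>)
  finally show ?thesis .
qed

end

context sym_summable
begin

lemma inner_random_shift:
  "(LINT t|leb01. cos (2 * pi * of_int k * t) * random_shift g \<omega> t) =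
     g k * cos (2 * pi * of_int k * \<omega> 0) * skew (1/2) (\<omega> 1)"
proof -
  note int = integrable_L2_mult[OF cpx_in_L2[OF random_shift_in_L2] fourier_in_L2]
  have "(LINT t|leb01. cos (2 * pi * of_int k * t) * random_shift g \<omega> t) =
      (LINT t|leb01. Re (of_real (random_shift g \<omega> t) * cnj (fourier k t)))"
    by (simp add: fourier_eq_cis mult.commute)
  also have "\<dots> = Re (l2inner (cpx (random_shift g \<omega>)) (fourier k))"
    unfolding l2inner_def by (rule integral_Re[OF int])
  finally show ?thesis by (simp add: coef_random_shift fourier_eq_cis)
qed

lemma response_random_shift:
  assumes "\<sigma> \<noteq> 0"
  shows "response \<sigma> (\<lambda>t. s * (2 * b * cos (2 * pi * of_int k * t))) (random_shift g)
      (noise (2 * b * g k / \<sigma>) q k s) \<omega> =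
    s * (2 * b * g k * cos (2 * pi * of_int k * \<omega> 0) * skew (1/2) (\<omega> 1)) * (1 - skew q (\<omega> 2))
      + \<sigma> * noise_scale (2 * b * g k / \<sigma>) q k * skew (1/2) (\<omega> 3)"
proof -
  have "(LINT t|leb01. s * (2 * b * cos (2 * pi * of_int k * t)) * random_shift g \<omega> t) =
      (LINT t|leb01. (s * 2 * b) * (cos (2 * pi * of_int k * t) * random_shift g \<omega> t))"
    by (simp add: mult_ac)
  also have "\<dots> = (s * 2 * b) * (g k * cos (2 * pi * of_int k * \<omega> 0) * skew (1/2) (\<omega> 1))"
    unfolding integral_mult_right_zero inner_random_shift ..
  finally show ?thesis
    using assms by (simp add: response_def noise_def perturbation_def field_simps)
qed

end

lemma measure_cube4_rare:
  assumes "0 < q" "q \<le> 1"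
  shows "{\<omega> \<in> space cube4. q \<le> \<omega> 2} \<in> sets cube4"
    and "measure cube4 {\<omega> \<in> space cube4. q \<le> \<omega> 2} = 1 - q"
proof -
  note [measurable] = measurable_cube4_nth
  show S: "{\<omega> \<in> space cube4. q \<le> \<omega> 2} \<in> sets cube4" by measurable
  have "measure cube4 {\<omega> \<in> space cube4. q \<le> \<omega> 2} = measure cube4 ({\<omega> \<in> space cube4. q \<le> \<omega> 2} \<inter> space cube4)"
    by (rule arg_cong[where f = "measure cube4"]) auto
  also have "\<dots> = (LINT \<omega>|cube4. indicator {\<omega> \<in> space cube4. q \<le> \<omega> 2} \<omega>)"
    by (rule Bochner_Integration.integral_indicator[symmetric])
  also have "\<dots> = (LINT \<omega>|cube4. indicator {q..} (\<omega> 2))"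
    by (intro Bochner_Integration.integral_cong) (auto simp: indicator_def)
  also have "\<dots> = (LINT x|leb01. indicator {q..} x)"
  proof -
    have "integrable leb01 (indicator {q..} :: real \<Rightarrow> real)"
      by (rule integrable_bounded_leb01[where B = 1]) (auto simp: indicator_def)
    then show ?thesis
      using integral_cube4_prod[of "\<lambda>_. 1" "\<lambda>_. 1" "indicator {q..}" "\<lambda>_. 1 :: real"]
      by (simp add: leb01.prob_space[simplified])
  qed
  also have "\<dots> = measure leb01 {q..1}"
    using assms by (simp add: max_def)
  also have "\<dots> = measure lborel {q..1}"
    using assms by (intro measure_restrict_space) auto
  finally show "measure cube4 {\<omega> \<in> space cube4. q \<le> \<omega> 2} = 1 - q" using assms by simp
qed

lemma gam_minus [simp]: "gam (- k) = gam k"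
  by (simp add: gam_def)

lemma gam_ge_1: "1 \<le> gam k"
  by (simp add: gam_def)

lemma gam_ge_sq: "(of_int k)\<^sup>2 \<le> gam k"
proof -
  have "1 * (of_int k)\<^sup>2 \<le> (2 * pi)\<^sup>2 * (of_int k)\<^sup>2"
    using pi_ge_two by (intro mult_right_mono one_le_power) auto
  then show ?thesis by (simp add: gam_def power_mult_distrib)
qed

lemma cosine_coef:
  assumes "1 \<le> k"
  shows "l2inner (cpx (\<lambda>t. 2 * b * cos (2 * pi * of_int k * t))) (fourier j) = (if j = k \<or> j = - k then b else 0)"
proof -
  have "cpx (\<lambda>t. 2 * b * cos (2 * pi * of_int k * t)) = (\<lambda>t. of_real b * fourier k t + of_real b * fourier (- k) t)"
    by (simp add: fun_eq_iff complex_eq_iff fourier_eq_cis)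
  then have "l2inner (cpx (\<lambda>t. 2 * b * cos (2 * pi * of_int k * t))) (fourier j) =
      (LINT t|leb01. of_real b * (fourier k t * cnj (fourier j t)) + of_real b * (fourier (- k) t * cnj (fourier j t)))"
    by (simp add: l2inner_def algebra_simps)
  also have "\<dots> = of_real b * l2inner (fourier k) (fourier j) + of_real b * l2inner (fourier (- k)) (fourier j)"
    using integrable_L2_mult[OF fourier_in_L2 fourier_in_L2] by (simp add: l2inner_def)
  finally show ?thesis using assms by (auto simp: l2inner_fourier)
qed

lemma sobnorm_sq_cosine:
  assumes "1 \<le> k"
  shows "sobnorm_sq p (cpx (\<lambda>t. 2 * b * cos (2 * pi * of_int k * t))) = ennreal (2 * gam k powr p * b\<^sup>2)"
proof -
  have "sobnorm_sq p (cpx (\<lambda>t. 2 * b * cos (2 * pi * of_int k * t))) =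
      (\<Sum>\<^sub>\<infinity>j\<in>{k, - k}. ennreal (gam j powr p * b\<^sup>2))"
    unfolding sobnorm_sq_def cosine_coef[OF assms] by (intro infsum_cong_neutral) auto
  also have "\<dots> = ennreal (2 * gam k powr p * b\<^sup>2)"
    using assms by (simp flip: ennreal_plus)
  finally show ?thesis .
qed

lemma cosine_in_sob_ball:
  assumes "1 \<le> k" "2 * gam k powr p * b\<^sup>2 \<le> \<rho>" "s = 1 \<or> s = - 1"
  shows "cpx (\<lambda>t. s * (2 * b * cos (2 * pi * of_int k * t))) \<in> sob_ball p \<rho>"
proof -
  have "\<bar>cos x\<bar> \<le> 1" for x :: real by simp
  then have "cpx (\<lambda>t. s * (2 * b * cos (2 * pi * of_int k * t))) \<in> L2"
    using assms(3) by (intro bounded_in_L2[where B = "2 * \<bar>b\<bar>"]) (auto simp: norm_mult mult_left_le)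
  moreover have "sobnorm_sq p (cpx (\<lambda>t. s * (2 * b * cos (2 * pi * of_int k * t)))) = ennreal (2 * gam k powr p * b\<^sup>2)"
    using assms(3) sobnorm_sq_cosine[OF assms(1), of p b] sobnorm_sq_cosine[OF assms(1), of p "- b"] by auto
  ultimately show ?thesis using assms(2) by (simp add: sob_ball_def ennreal_leI)
qed

lemma (in sym_summable) minimax_ge_two_point:
  assumes est: "est \<in> estimators n" and n: "1 \<le> n" and "\<sigma> > 0"
    and g: "\<And>k. g k \<noteq> 0" "(\<lambda>k. (g k)\<^sup>2) \<in> link_class \<kappa> d \<nu> p" "(LINT k|count_space UNIV. (g k)\<^sup>2) \<le> \<Lambda>"
    and "1 \<le> \<tau>" and \<eta>: "2 ^ l \<le> \<eta>" and k: "1 \<le> k"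
    and b: "2 * gam k powr p * b\<^sup>2 \<le> \<rho>" "\<bar>2 * b * g k / \<sigma>\<bar> \<le> 1 / (2 * real n)"
  shows "ennreal (gam k powr \<nu> * b\<^sup>2 / 2) \<le> (SUP (\<beta>, M, X, W, U)\<in>models \<kappa> d \<nu> p \<rho> m l \<eta> \<tau> \<Lambda>.
    risk \<sigma> \<nu> n est \<beta> M X W U)" (is "_ \<le> ?S")
proof -
  define q where "q = 1 / (2 * real n)"
  define A where "A = 2 * b * g k / \<sigma>"
  define \<beta> where "\<beta> s t = s * (2 * b * cos (2 * pi * of_int k * t))" for s t
  have q: "0 < q" "q \<le> 1" using n by (auto simp: q_def field_simps)
  have \<eta>1: "1 \<le> \<eta>" by (rule order_trans[OF one_le_power \<eta>]) simp
  have le: "risk \<sigma> \<nu> n est (\<beta> s) cube4 (random_shift g) (random_shift g) (noise A q k s) \<le> ?S"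
    if s: "s = 1 \<or> s = - 1" for s
  proof -
    interpret perturbed_noise A q s k
      using q b(2) s by unfold_locales (simp_all only: A_def q_def)
    have "(\<beta> s, cube4, random_shift g, random_shift g, noise A q k s) \<in> models \<kappa> d \<nu> p \<rho> m l \<eta> \<tau> \<Lambda>"
      unfolding models_def \<beta>_def
      using cosine_in_sob_ball[OF k b(1) s] random_shift_in_F_link[OF g(1) \<eta>1 \<open>1 \<le> \<tau>\<close> g(2,3)]
        noise_in_E_moment[OF \<eta>] noise_uncorrelated[OF sym_summable_axioms]
      by simp
    then show ?thesis by (rule SUP_upper2) simp
  qed
  have \<beta>_minus: "\<beta> (- 1) = (\<lambda>t. - \<beta> 1 t)" by (simp add: \<beta>_def fun_eq_iff)
  have coef: "l2inner (cpx (\<beta> 1)) (fourier k) = b"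
    using cosine_coef[OF k, of b k] by (simp add: \<beta>_def)
  have resp: "response \<sigma> (\<beta> s) (random_shift g) (noise A q k s) \<omega> = \<sigma> * noise_scale A q k * skew (1/2) (\<omega> 3)"
    if "q \<le> \<omega> 2" for s \<omega>
    using response_random_shift[of \<sigma> s b k q \<omega>] \<open>\<sigma> > 0\<close> that
    by (simp add: \<beta>_def[abs_def] A_def skew_def)
  have "\<beta> 1 \<in> L2"
  proof (rule bounded_in_L2)
    show "norm (\<beta> 1 t) \<le> 2 * \<bar>b\<bar>" for t by (simp add: \<beta>_def abs_mult mult_left_le)
    show "\<beta> 1 \<in> borel_measurable leb01" unfolding \<beta>_def by measurable
  qed
  moreover have "response \<sigma> (\<beta> 1) (random_shift g) (noise A q k 1) \<omega> =
      response \<sigma> (\<lambda>t. - \<beta> 1 t) (random_shift g) (noise A q k (- 1)) \<omega>" if "q \<le> \<omega> 2" for \<omega>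
    using resp[of \<omega> 1] resp[of \<omega> "- 1"] that by (simp only: \<beta>_minus[symmetric])
  ultimately have "ennreal (2 * gam k powr \<nu> * (cmod (l2inner (cpx (\<beta> 1)) (fourier k)))\<^sup>2 * (1 - real n * q))
    \<le> risk \<sigma> \<nu> n est (\<beta> 1) cube4 (random_shift g) (random_shift g) (noise A q k 1)
      + risk \<sigma> \<nu> n est (\<beta> (- 1)) cube4 (random_shift g) (random_shift g) (noise A q k (- 1))"
    unfolding \<beta>_minus using measure_cube4_rare[OF q] q random_function_shift
    by (intro two_point_risk[OF est prob_space_cube4, where A = "{\<omega> \<in> space cube4. q \<le> \<omega> 2}"]) auto
  also have "\<dots> \<le> ?S + ?S" by (intro add_mono le) auto
  also have "2 * gam k powr \<nu> * (cmod (l2inner (cpx (\<beta> 1)) (fourier k)))\<^sup>2 * (1 - real n * q) = gam k powr \<nu> * b\<^sup>2"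
    using n by (simp add: coef q_def)
  finally have S: "ennreal (gam k powr \<nu> * b\<^sup>2) \<le> ?S + ?S" .
  show ?thesis
  proof (cases ?S)
    case (real r)
    with S have "gam k powr \<nu> * b\<^sup>2 \<le> r + r" by (simp flip: ennreal_plus)
    then show ?thesis unfolding real by (intro ennreal_leI) simp
  next
    case top
    then show ?thesis by (simp only: top_greatest)
  qed
qed

subsection \<open>The logarithmic rate\<close>

lemma summable_inverse_gam: "integrable (count_space UNIV) (\<lambda>k. 1 / gam k)"
proof -
  have "summable (\<lambda>n. norm (1 / gam (int n)))"
  proof (rule summable_comparison_test')
    show "summable (\<lambda>n. inverse (real n ^ 2))" by (rule inverse_power_summable) simp
    show "norm (norm (1 / gam (int n))) \<le> inverse (real n ^ 2)" if "1 \<le> n" for n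
      using gam_ge_sq[of "int n"] gam_pos[of "int n"] that
      by (simp add: inverse_eq_divide) (intro divide_left_mono, auto)
  qed
  then have nat: "Infinite_Set_Sum.abs_summable_on (\<lambda>n. 1 / gam (int n)) UNIV"
    by (simp add: abs_summable_on_nat_iff')
  have "Infinite_Set_Sum.abs_summable_on (\<lambda>k. 1 / gam k) (range int)"
    using nat by (subst abs_summable_on_reindex_iff[symmetric]) auto
  moreover have "Infinite_Set_Sum.abs_summable_on (\<lambda>k. 1 / gam k) (range (\<lambda>n. - int n))"
    using nat by (subst abs_summable_on_reindex_iff[symmetric]) (auto simp: inj_on_def)
  ultimately have "Infinite_Set_Sum.abs_summable_on (\<lambda>k. 1 / gam k) ((range int \<union> range (\<lambda>n. - int n)))"
    by (rule abs_summable_on_union)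
  also have "range int \<union> range (\<lambda>n. - int n) = UNIV"
    by (auto simp: image_iff) (metis int_cases2)
  finally show ?thesis by (simp add: abs_summable_on_def)
qed

lemma powr_exp_le_inverse:
  fixes a c :: real
  assumes "0 < a" "0 \<le> c"
  obtains C where "\<And>x. 1 \<le> x \<Longrightarrow> x powr c * exp (- (x powr a) / 2) \<le> C / x"
proof -
  have "((\<lambda>x::real. x powr (c + 1) * exp (- (x powr a) / 2)) \<longlongrightarrow> 0) at_top"
    using assms by real_asymp
  then have "eventually (\<lambda>x::real. x powr (c + 1) * exp (- (x powr a) / 2) < 1) at_top"
    by (rule order_tendstoD) simp
  then obtain N where N: "\<And>x. N \<le> x \<Longrightarrow> x powr (c + 1) * exp (- (x powr a) / 2) < 1"
    by (auto simp: eventually_at_top_linorder)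
  define C where "C = max 1 (\<bar>N\<bar> powr (c + 1))"
  have "x powr c * exp (- (x powr a) / 2) \<le> C / x" if x: "1 \<le> x" for x
  proof -
    have "x powr (c + 1) * exp (- (x powr a) / 2) \<le> C"
    proof (cases "N \<le> x")
      case True
      then show ?thesis using N[of x] by (simp add: C_def)
    next
      case False
      have "x powr (c + 1) * exp (- (x powr a) / 2) \<le> x powr (c + 1) * 1"
        by (intro mult_left_mono) auto
      also have "\<dots> \<le> \<bar>N\<bar> powr (c + 1)" using False x assms by (simp add: powr_mono2)
      finally show ?thesis by (simp add: C_def)
    qed
    then show ?thesis using x by (simp add: powr_add field_simps)
  qed
  then show ?thesis by (rule that)
qed

lemma integrable_sqrt_of_decay:
  fixes ls :: "int \<Rightarrow> real"
  assumes "0 < a" "0 \<le> \<nu>" "0 \<le> K" and ls: "\<And>k. 0 \<le> ls k" "\<And>k. ls k \<le> K * (gam k powr \<nu> * exp (- (gam k powr a)))"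
  shows "integrable (count_space UNIV) (\<lambda>k. sqrt (ls k))"
proof -
  obtain C where C: "\<And>x. 1 \<le> x \<Longrightarrow> x powr (\<nu> / 2) * exp (- (x powr a) / 2) \<le> C / x"
    using powr_exp_le_inverse[of a "\<nu> / 2"] assms by auto
  show ?thesis
  proof (rule Bochner_Integration.integrable_bound)
    show "integrable (count_space UNIV) (\<lambda>k. sqrt K * C * (1 / gam k))"
      by (intro integrable_mult_right summable_inverse_gam)
    have "sqrt (ls k) \<le> sqrt K * C * (1 / gam k)" for k
    proof -
      have "gam k powr \<nu> = (gam k powr (\<nu> / 2))\<^sup>2" "exp (- (gam k powr a)) = (exp (- (gam k powr a) / 2))\<^sup>2"
        by (simp_all add: power2_eq_square flip: powr_add exp_add)
      then have "gam k powr \<nu> * exp (- (gam k powr a)) = (gam k powr (\<nu> / 2) * exp (- (gam k powr a) / 2))\<^sup>2"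
        by (simp only: power_mult_distrib)
      then have "sqrt (ls k) \<le> sqrt (K * (gam k powr (\<nu> / 2) * exp (- (gam k powr a) / 2))\<^sup>2)"
        using ls(2)[of k] by (intro real_sqrt_le_mono) simp
      also have "\<dots> = sqrt K * (gam k powr (\<nu> / 2) * exp (- (gam k powr a) / 2))"
        by (simp add: real_sqrt_mult)
      also have "\<dots> \<le> sqrt K * (C / gam k)"
        using C[OF gam_ge_1] assms by (intro mult_left_mono) auto
      finally show ?thesis by simp
    qed
    then have "norm (sqrt (ls k)) \<le> norm (sqrt K * C * (1 / gam k))" for k
      using ls(1)[of k] by (simp only: real_norm_def abs_of_nonneg real_sqrt_ge_zero order_trans[OF _ abs_ge_self])
    then show "AE k in count_space UNIV. norm (sqrt (ls k)) \<le> norm (sqrt K * C * (1 / gam k))"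
      by simp
  qed simp
qed

lemma frequency_of_log_size:
  fixes a :: real
  assumes "0 < a"
  obtains K where "0 < K" "\<And>L. ln 2 \<le> L \<Longrightarrow> \<exists>k\<ge>1. 2 * L \<le> gam k powr a \<and> gam k \<le> K * L powr (1 / a)"
proof -
  define K where "K = max (gam 1 / ln 2 powr (1 / a)) (4 * 2 powr (1 / a))"
  have "0 < K" by (simp add: K_def less_max_iff_disj)
  moreover have "\<exists>k\<ge>1. 2 * L \<le> gam k powr a \<and> gam k \<le> K * L powr (1 / a)" if L: "ln 2 \<le> L" for L
  proof -
    have L0: "0 < L" using L ln_gt_zero[of 2] by linarith
    define P where "P j \<longleftrightarrow> 2 * L \<le> gam (int (Suc j)) powr a" for j
    obtain j0 :: nat where "(2 * L) powr (1 / a) \<le> real j0" using real_arch_simple by blast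
    also have "real j0 \<le> gam (int (Suc j0))"
    proof -
      have "real j0 \<le> real (Suc j0) * real (Suc j0)" by (simp add: algebra_simps)
      then show ?thesis using gam_ge_sq[of "int (Suc j0)"] by (simp add: power2_eq_square)
    qed
    finally have "((2 * L) powr (1 / a)) powr a \<le> gam (int (Suc j0)) powr a"
      using assms by (intro powr_mono2) auto
    then have ex: "P j0" using assms L0 by (simp add: P_def powr_powr)
    define j where "j = (LEAST j. P j)"
    have j: "P j" unfolding j_def using ex by (rule LeastI)
    have "gam (int (Suc j)) \<le> K * L powr (1 / a)"
    proof (cases j)
      case 0
      have "gam 1 = gam 1 / ln 2 powr (1 / a) * ln 2 powr (1 / a)" by simp
      also have "\<dots> \<le> K * L powr (1 / a)"
        using L assms gam_pos[of 1] by (intro mult_mono powr_mono2) (auto simp: K_def le_max_iff_disj)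
      finally show ?thesis using 0 by simp
    next
      case (Suc i)
      then have "\<not> P i" unfolding j_def using not_less_Least[of i P] by simp
      then have "gam (int (Suc i)) powr a < 2 * L" by (simp add: P_def)
      then have "(gam (int (Suc i)) powr a) powr (1 / a) \<le> (2 * L) powr (1 / a)"
        using assms by (intro powr_mono2) auto
      then have i: "gam (int (Suc i)) \<le> 2 powr (1 / a) * L powr (1 / a)"
        using assms L0 gam_pos[of "int (Suc i)"] by (simp add: powr_powr powr_mult)
      have "gam (int (Suc j)) \<le> 4 * gam (int (Suc i))"
        unfolding gam_def Suc by (simp add: power2_eq_square algebra_simps)
      also have "\<dots> \<le> 4 * 2 powr (1 / a) * L powr (1 / a)" using i by simp
      also have "\<dots> \<le> K * L powr (1 / a)" by (intro mult_right_mono) (auto simp: K_def)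
      finally show ?thesis .
    qed
    then show ?thesis using j by (intro exI[of _ "int (Suc j)"]) (auto simp: P_def)
  qed
  ultimately show ?thesis by (rule that)
qed

lemma F_link_log_index:
  assumes "a > 0" "\<nu> < p" "1 \<le> d" "1 \<le> \<Lambda>"
    and \<kappa>: "\<And>t. t \<in> {0<..<1} \<Longrightarrow> \<kappa> t = \<bar>ln t\<bar> powr (- ((p - \<nu>) / a))"
    and F: "(M, X, W) \<in> F_link \<kappa> d \<nu> p m \<eta> \<tau> \<Lambda>"
  shows "0 < lam M X W k" "lam M X W k \<le> d * \<Lambda> * (gam k powr \<nu> * exp (- (gam k powr a)))"
    "(\<Sum>\<^sub>\<infinity>k. lam M X W k) \<le> \<Lambda>"
proof -
  let ?l = "lam M X W"
  have st: "stationary_pair M X W" and link: "?l \<in> link_class \<kappa> d \<nu> p"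
    and X: "(LINT \<omega>|M. (l2norm (X \<omega>))\<^sup>2) \<le> \<Lambda>"
    using F by (auto simp: F_link_def F_moment_def)
  have sum: "(\<Sum>k\<in>F. ?l k) \<le> \<Lambda>" if "finite F" for F
    using sum_lam_le[OF st that] X by linarith
  then have "?l k \<le> \<Lambda>" for k
    using sum[of "{k}"] by simp
  then have plus: "1 \<le> lam_plus ?l" "lam_plus ?l \<le> \<Lambda>"
    using assms(4) by (auto simp: lam_plus_def intro!: cSUP_least)
  have "(\<nu> - p) * (- (a / (p - \<nu>))) = (p - \<nu>) * (a / (p - \<nu>))"
    unfolding minus_diff_eq[of p \<nu>, symmetric] by (rule minus_mult_minus)
  also have "\<dots> = a" using assms(2) by simp
  finally have "(gam k powr (\<nu> - p)) powr (- (a / (p - \<nu>))) = gam k powr a"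
    by (simp only: powr_powr)
  then have inv: "the_inv_into {0<..<1} \<kappa> (gam k powr (\<nu> - p)) = exp (- (gam k powr a))"
    using the_inv_into_log_index[OF assms(1,2) _ \<kappa>, of "gam k powr (\<nu> - p)"] gam_pos[of k] by simp
  have pos: "0 < gam k powr \<nu> * lam_plus ?l"
    using plus gam_pos[of k] by simp
  have lo: "inverse d * exp (- (gam k powr a)) \<le> ?l k / (gam k powr \<nu> * lam_plus ?l)"
    and hi: "?l k / (gam k powr \<nu> * lam_plus ?l) \<le> d * exp (- (gam k powr a))"
    using link unfolding link_class_def inv[symmetric] by blast+
  have "0 < inverse d * exp (- (gam k powr a))" using assms(3) by simp
  also note lo
  finally show "0 < ?l k" using pos by (simp add: zero_less_divide_iff)
  have "?l k \<le> d * exp (- (gam k powr a)) * (gam k powr \<nu> * lam_plus ?l)"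
    using hi pos by (simp add: divide_le_eq)
  also have "\<dots> \<le> d * exp (- (gam k powr a)) * (gam k powr \<nu> * \<Lambda>)"
    using plus assms(3) by (intro mult_left_mono) auto
  finally show "?l k \<le> d * \<Lambda> * (gam k powr \<nu> * exp (- (gam k powr a)))"
    by (simp add: mult_ac)
  have "?l summable_on UNIV" using link by (simp add: link_class_def)
  then show "(\<Sum>\<^sub>\<infinity>k. ?l k) \<le> \<Lambda>"
    by (rule infsum_le_finite_sums) (use sum in auto)
qed

theorem proposition4p3:
  fixes \<sigma> p \<rho> a \<nu> d \<tau> \<Lambda> :: real and m l :: nat
    and \<kappa> \<phi> :: "real \<Rightarrow> real"
  assumes "\<sigma> > 0" "p > 0" "\<rho> > 0" "a > 0"
    and "0 \<le> \<nu>" "\<nu> < p"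
    and "d \<ge> 1" "\<tau> \<ge> 1" "\<Lambda> \<ge> 1"
    and \<kappa>: "\<And>t. t \<in> {0<..<1} \<Longrightarrow> \<kappa> t = \<bar>ln t\<bar> powr (- ((p - \<nu>) / a))"
    and \<phi>: "\<And>s. s > 0 \<Longrightarrow> \<phi> s = exp (- (s powr (- (a / (p - \<nu>)))))"
    and nonempty: "\<exists>\<eta>\<^sub>0\<ge>1. \<forall>\<eta>\<ge>\<eta>\<^sub>0.
      (F_link \<kappa> d \<nu> p m \<eta> \<tau> \<Lambda>
         :: (\<Omega> measure \<times> (\<Omega> \<Rightarrow> real \<Rightarrow> real) \<times> (\<Omega> \<Rightarrow> real \<Rightarrow> real)) set) \<noteq> {}"
  shows "\<exists>\<eta>\<^sub>0\<ge>1. \<forall>\<eta>\<ge>\<eta>\<^sub>0. \<forall>\<Delta>\<ge>1. \<exists>C>0. \<forall>n\<ge>2.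
    (\<exists>k\<^sub>s::nat.
       1 / \<Delta> \<le> (\<Sum>k\<in>{- int k\<^sub>s..int k\<^sub>s}.
                  gam (int k\<^sub>s) powr (p - \<nu>) / (real n * \<phi> (gam k powr (\<nu> - p)))) \<and>
       (\<Sum>k\<in>{- int k\<^sub>s..int k\<^sub>s}.
          gam (int k\<^sub>s) powr (p - \<nu>) / (real n * \<phi> (gam k powr (\<nu> - p)))) \<le> \<Delta>)
    \<longrightarrow> ennreal (C * ln (real n) powr (- ((p - \<nu>) / a)))
        \<le> (INF est\<in>estimators n. SUP (\<beta>, M, X, W, U)\<in>models \<kappa> d \<nu> p \<rho> m l \<eta> \<tau> \<Lambda>.
             risk \<sigma> \<nu> n est \<beta> M X W U)"
proof -
  obtain \<eta>\<^sub>1 and M :: "\<Omega> measure" and X W where F: "(M, X, W) \<in> F_link \<kappa> d \<nu> p m \<eta>\<^sub>1 \<tau> \<Lambda>"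
    using nonempty by fastforce
  define ls where "ls = lam M X W"
  note ls = F_link_log_index[OF \<open>a > 0\<close> \<open>\<nu> < p\<close> \<open>d \<ge> 1\<close> \<open>\<Lambda> \<ge> 1\<close> \<kappa> F, folded ls_def]
  have link: "ls \<in> link_class \<kappa> d \<nu> p" using F by (simp add: F_link_def ls_def)
  define g where "g k = sqrt (ls k)" for k
  have g_sq: "(\<lambda>k. (g k)\<^sup>2) = ls"
    using ls(1) by (simp add: g_def fun_eq_iff less_imp_le)
  have g_nonzero: "g k \<noteq> 0" for k using ls(1)[of k] by (simp add: g_def)
  interpret sym_summable g
  proof
    show "integrable (count_space UNIV) g"
      unfolding g_def[abs_def] using assms ls(1)
      by (intro integrable_sqrt_of_decay[OF \<open>a > 0\<close> \<open>0 \<le> \<nu>\<close> _ _ ls(2)]) (auto simp: less_imp_le)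
    show "g (- k) = g k" for k by (simp add: g_def ls_def lam_minus)
  qed
  have "integrable (count_space UNIV) ls"
    using sym_summable.summable[OF sq_summable] by (simp add: g_sq)
  then have "(LINT k|count_space UNIV. ls k) = (\<Sum>\<^sub>\<infinity>k. ls k)"
    using infsetsum_infsum[of ls UNIV] by (simp add: Infinite_Set_Sum.abs_summable_on_def infsetsum_def)
  then have total: "(LINT k|count_space UNIV. (g k)\<^sup>2) \<le> \<Lambda>" using ls(3) by (simp add: g_sq[THEN fun_cong])

  obtain K where K: "0 < K"
    "\<And>L. ln 2 \<le> L \<Longrightarrow> \<exists>k\<ge>1. 2 * L \<le> gam k powr a \<and> gam k \<le> K * L powr (1 / a)"
    using frequency_of_log_size[OF \<open>a > 0\<close>] by blast
  define r where "r = min (\<rho> / 2) (\<sigma>\<^sup>2 / (16 * (d * \<Lambda>)))"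
  have r: "0 < r" "2 * r \<le> \<rho>" "16 * r * (d * \<Lambda>) \<le> \<sigma>\<^sup>2"
  proof -
    have dL: "0 < d * \<Lambda>" using assms by simp
    then show "0 < r" using assms by (simp add: r_def)
    show "2 * r \<le> \<rho>" by (simp add: r_def)
    have "r \<le> \<sigma>\<^sup>2 / (16 * (d * \<Lambda>))" by (simp add: r_def)
    then show "16 * r * (d * \<Lambda>) \<le> \<sigma>\<^sup>2" using dL by (simp add: field_simps)
  qed
  define C where "C = r / 2 * K powr (\<nu> - p)"
  have "0 < C" using r K by (simp add: C_def)

  have bound: "ennreal (C * ln (real n) powr (- ((p - \<nu>) / a)))
      \<le> (SUP (\<beta>, M, X, W, U)\<in>models \<kappa> d \<nu> p \<rho> m l \<eta> \<tau> \<Lambda>. risk \<sigma> \<nu> n est \<beta> M X W U)"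
    if n: "2 \<le> n" and \<eta>: "2 ^ l \<le> \<eta>" and est: "est \<in> estimators n" for n \<eta> est
  proof -
    have L: "ln 2 \<le> ln (real n)" "0 < ln (real n)" using n by auto
    obtain k where k: "1 \<le> k" "2 * ln (real n) \<le> gam k powr a" "gam k \<le> K * ln (real n) powr (1 / a)"
      using K(2)[OF L(1)] by auto
    define b where "b = sqrt (r * gam k powr (- p))"
    have b_sq: "b\<^sup>2 = r * gam k powr (- p)" using r by (simp add: b_def)
    have pow: "gam k powr x * gam k powr (- p) = gam k powr (x - p)" for x
      by (simp add: powr_add[symmetric])
    have b1: "2 * gam k powr p * b\<^sup>2 \<le> \<rho>"
      using r pow[of p] gam_pos[of k] by (simp add: b_sq mult_ac)
    have exp_le: "(real n)\<^sup>2 * exp (- (gam k powr a)) \<le> 1"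
    proof -
      have "(real n)\<^sup>2 * exp (- (gam k powr a)) \<le> (real n)\<^sup>2 * exp (- (2 * ln (real n)))"
        using k(2) by (intro mult_left_mono) auto
      also have "\<dots> = 1"
        using n by (simp add: exp_minus exp_double field_simps)
      finally show ?thesis .
    qed
    have "(2 * b * g k * (2 * real n))\<^sup>2 = 16 * (b\<^sup>2 * ls k * (real n)\<^sup>2)"
      using g_sq[THEN fun_cong, of k] by (simp add: power_mult_distrib)
    also have "\<dots> \<le> 16 * (b\<^sup>2 * (d * \<Lambda> * (gam k powr \<nu> * exp (- (gam k powr a)))) * (real n)\<^sup>2)"
      by (intro mult_left_mono mult_right_mono ls(2)) auto
    also have "\<dots> = 16 * r * (d * \<Lambda>) * (gam k powr (\<nu> - p) * ((real n)\<^sup>2 * exp (- (gam k powr a))))"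
      by (simp add: b_sq pow[symmetric] mult_ac)
    also have "\<dots> \<le> 16 * r * (d * \<Lambda>) * (1 * 1)"
      using exp_le powr_mono[of "\<nu> - p" 0 "gam k"] gam_ge_1[of k] gam_pos[of k] assms r
      by (intro mult_left_mono mult_mono) auto
    also have "\<dots> \<le> \<sigma>\<^sup>2" using r(3) by simp
    finally have "\<bar>2 * b * g k * (2 * real n)\<bar>\<^sup>2 \<le> \<sigma>\<^sup>2" by (simp only: power2_abs)
    then have "\<bar>2 * b * g k * (2 * real n)\<bar> \<le> \<sigma>"
      by (rule power2_le_imp_le) (use \<open>\<sigma> > 0\<close> in simp)
    then have "\<bar>2 * b * g k\<bar> * (2 * real n) \<le> \<sigma>"
      unfolding abs_mult[of "2 * b * g k"] by simp
    then have "\<bar>2 * b * g k\<bar> / \<sigma> \<le> 1 / (2 * real n)"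
      using n \<open>\<sigma> > 0\<close> by (subst frac_le_eq) (auto simp: divide_le_0_iff)
    then have b2: "\<bar>2 * b * g k / \<sigma>\<bar> \<le> 1 / (2 * real n)"
      using \<open>\<sigma> > 0\<close> by (simp only: abs_divide abs_of_pos)
    have "1 / a * (\<nu> - p) = - ((p - \<nu>) / a)" by (simp add: minus_divide_left)
    then have "C * ln (real n) powr (- ((p - \<nu>) / a)) = r / 2 * (K * ln (real n) powr (1 / a)) powr (\<nu> - p)"
      using K L by (simp only: C_def powr_mult powr_powr mult.assoc)
    also have "\<dots> \<le> r / 2 * gam k powr (\<nu> - p)"
      using k(3) gam_pos[of k] r \<open>\<nu> < p\<close> by (intro mult_left_mono powr_mono2') auto
    also have "\<dots> = gam k powr \<nu> * b\<^sup>2 / 2"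
      by (simp add: b_sq pow[symmetric])
    finally have "ennreal (C * ln (real n) powr (- ((p - \<nu>) / a))) \<le> ennreal (gam k powr \<nu> * b\<^sup>2 / 2)"
      by (rule ennreal_leI)
    also have "\<dots> \<le> (SUP (\<beta>, M, X, W, U)\<in>models \<kappa> d \<nu> p \<rho> m l \<eta> \<tau> \<Lambda>. risk \<sigma> \<nu> n est \<beta> M X W U)"
      using n link
      by (intro minimax_ge_two_point[OF est _ \<open>\<sigma> > 0\<close> g_nonzero _ total \<open>\<tau> \<ge> 1\<close> \<eta> k(1) b1 b2])
         (simp_all add: g_sq)
    finally show ?thesis .
  qed
  show ?thesis
  proof (rule exI[of _ "2 ^ l"], intro conjI allI impI)
    fix \<eta> \<Delta> :: real assume "2 ^ l \<le> \<eta>"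
    with bound \<open>0 < C\<close> show "\<exists>C>0. \<forall>n\<ge>2.
      (\<exists>k\<^sub>s::nat.
       1 / \<Delta> \<le> (\<Sum>k\<in>{- int k\<^sub>s..int k\<^sub>s}.
                  gam (int k\<^sub>s) powr (p - \<nu>) / (real n * \<phi> (gam k powr (\<nu> - p)))) \<and>
       (\<Sum>k\<in>{- int k\<^sub>s..int k\<^sub>s}.
          gam (int k\<^sub>s) powr (p - \<nu>) / (real n * \<phi> (gam k powr (\<nu> - p)))) \<le> \<Delta>)
      \<longrightarrow> ennreal (C * ln (real n) powr (- ((p - \<nu>) / a)))
        \<le> (INF est\<in>estimators n. SUP (\<beta>, M, X, W, U)\<in>models \<kappa> d \<nu> p \<rho> m l \<eta> \<tau> \<Lambda>.
             risk \<sigma> \<nu> n est \<beta> M X W U)"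
      by (intro exI[of _ C] conjI allI impI INF_greatest) auto
  qed simp
qed

end
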